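(* Let $K$ be a field, let $G$ be a connected (simple) graph on the vertex set $[n]=\{1,\ldots,n\}$, and let $J_G\subset S=K[x_1,\ldots,x_n,y_1,\ldots,y_n]$ be its binomial edge ideal. Let $<$ be the lexicographic order on $S$ with $x_1>x_2>\cdots>x_n>y_1>y_2>\cdots>y_n$. If the initial ideal $\operatorname{in}_<(J_G)$ is a normally torsion-free ideal, then $J_G^{(k)}=J_G^k$ for all integers $k\geq 1$.
   Context: The binomial edge ideal of a simple graph $G$ on $[n]$ with edge set $E(G)$ is $J_G=(x_iy_j-x_jy_i : i<j,\ \{i,j\}\in E(G))\subset S$. The initial ideal $\operatorname{in}_<(I)$ is the ideal generated by the leading monomials with respect to $<$ of the nonzero elements of $I$. An ideal $I$ is normally torsion-free if $\operatorname{Ass}(I^m)\subseteq\operatorname{Ass}(I)$ for all $m\geq 1$, where $\operatorname{Ass}(I)$ denotes the set of associated primes of $S/I$. For an ideal $I$ in a Noetherian ring $R$ with set of minimal primes $\operatorname{Min}(I)$ and $k\ge 1$, the $k$-th symbolic power of $I$ is $I^{(k)}=\bigcap_{\mathfrak p\in\operatorname{Min}(I)}(I^kR_{\mathfrak p}\cap R)$, equivalently $I^{(k)}=\{a\in R:\text{ there exists } w\notin\bigcup_{\mathfrak p\in\operatorname{Min}(I)}\mathfrak p \text{ with } wa\in I^k\}$. *)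

theory Defs
  imports
    "HOL-Library.Poly_Mapping"
    "HOL-Algebra.Ideal_Product"
    "HOL-Algebra.QuotRing"
    "Graph_Theory.Digraph_Component"
    "Graph_Theory.Pair_Digraph"
begin

datatype bvar = X_var nat | Y_var nat

type_synonym bmon = "bvar \<Rightarrow>\<^sub>0 nat"

type_synonym 'k bpoly = "bmon \<Rightarrow>\<^sub>0 'k"

definition vars_upto :: "nat \<Rightarrow> bvar set" where
  "vars_upto n = X_var ` {1..n} \<union> Y_var ` {1..n}"

(* K[x_1,...,x_n,y_1,...,y_n], cut out of the polynomials in infinitely many
   variables; the field K is the type 'k. *)
definition bpoly_ring :: "nat \<Rightarrow> ('k::field) bpoly ring" where
  "bpoly_ring n =
     \<lparr>carrier = {p. \<forall>m \<in> Poly_Mapping.keys p. Poly_Mapping.keys m \<subseteq> vars_upto n},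
      monoid.mult = (*), one = 1, zero = 0, add = (+)\<rparr>"

definition x_poly :: "nat \<Rightarrow> ('k::field) bpoly" where
  "x_poly i = Poly_Mapping.single (Poly_Mapping.single (X_var i) 1) 1"

definition y_poly :: "nat \<Rightarrow> ('k::field) bpoly" where
  "y_poly i = Poly_Mapping.single (Poly_Mapping.single (Y_var i) 1) 1"


(* A simple graph is a pair_graph: an edge {i,j} is the pair of arcs (i,j), (j,i). *)
definition binomial_edge_ideal :: "nat \<Rightarrow> nat pair_pre_digraph \<Rightarrow> ('k::field) bpoly set" where
  "binomial_edge_ideal n G =
     Idl\<^bsub>bpoly_ring n\<^esub> {x_poly i * y_poly j - x_poly j * y_poly i | i j. i < j \<and> (i, j) \<in> parcs G}"


(* x_1 > x_2 > ... > y_1 > y_2 > ... *)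
fun var_gt :: "bvar \<Rightarrow> bvar \<Rightarrow> bool" where
  "var_gt (X_var i) (X_var j) \<longleftrightarrow> i < j"
| "var_gt (X_var i) (Y_var j) \<longleftrightarrow> True"
| "var_gt (Y_var i) (X_var j) \<longleftrightarrow> False"
| "var_gt (Y_var i) (Y_var j) \<longleftrightarrow> i < j"

(* Written out because the library order on poly_mapping, also lexicographic,
   is relative to a linear order on the variables in which the smallest variable
   is the most significant one. *)
definition lex_less :: "bmon \<Rightarrow> bmon \<Rightarrow> bool" where
  "lex_less a b \<longleftrightarrow>
     (\<exists>v. Poly_Mapping.lookup a v < Poly_Mapping.lookup b v \<and>
          (\<forall>w. var_gt w v \<longrightarrow> Poly_Mapping.lookup a w = Poly_Mapping.lookup b w))"

(* Only meaningful for p \<noteq> 0; see lead_mon_unique. *)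
definition lead_mon :: "('k::field) bpoly \<Rightarrow> bmon" where
  "lead_mon p = (THE m. m \<in> Poly_Mapping.keys p \<and>
     (\<forall>m' \<in> Poly_Mapping.keys p. m' \<noteq> m \<longrightarrow> lex_less m' m))"

definition initial_ideal :: "nat \<Rightarrow> ('k::field) bpoly set \<Rightarrow> 'k bpoly set" where
  "initial_ideal n I =
     Idl\<^bsub>bpoly_ring n\<^esub> {Poly_Mapping.single (lead_mon f) 1 | f. f \<in> I \<and> f \<noteq> 0}"


abbreviation ideal_power :: "('a, 'b) ring_scheme \<Rightarrow> 'a set \<Rightarrow> nat \<Rightarrow> 'a set" where
  "ideal_power R I m \<equiv> I [^]\<^bsub>ideals_set R\<^esub> m"

(* The primes that are annihilators of an element c of the R-module R/I;
   a in R acts on R/I as multiplication by the coset I + a. *)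
definition Ass :: "('a, 'b) ring_scheme \<Rightarrow> 'a set \<Rightarrow> 'a set set" where
  "Ass R I = {P. primeideal P R \<and>
     (\<exists>c \<in> carrier (R Quot I).
        P = {a \<in> carrier R. (I +>\<^bsub>R\<^esub> a) \<otimes>\<^bsub>R Quot I\<^esub> c = \<zero>\<^bsub>R Quot I\<^esub>})}"

definition normally_torsion_free :: "('a, 'b) ring_scheme \<Rightarrow> 'a set \<Rightarrow> bool" where
  "normally_torsion_free R I \<longleftrightarrow> (\<forall>m::nat. m \<ge> 1 \<longrightarrow> Ass R (ideal_power R I m) \<subseteq> Ass R I)"

definition min_primes :: "('a, 'b) ring_scheme \<Rightarrow> 'a set \<Rightarrow> 'a set set" where
  "min_primes R I = {P. primeideal P R \<and> I \<subseteq> P \<and>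
     (\<forall>Q. primeideal Q R \<longrightarrow> I \<subseteq> Q \<longrightarrow> Q \<subseteq> P \<longrightarrow> Q = P)}"

definition symbolic_power :: "('a, 'b) ring_scheme \<Rightarrow> 'a set \<Rightarrow> nat \<Rightarrow> 'a set" where
  "symbolic_power R I k = {a \<in> carrier R.
     \<exists>w \<in> carrier R. w \<notin> \<Union>(min_primes R I) \<and> w \<otimes>\<^bsub>R\<^esub> a \<in> ideal_power R I k}"


lemma cring_bpoly_ring: "cring (bpoly_ring n :: ('k::field) bpoly ring)"
proof -
  let ?C = "carrier (bpoly_ring n :: 'k bpoly ring)"
  have add: "p + q \<in> ?C" if "p \<in> ?C" "q \<in> ?C" for p q
    using that Poly_Mapping.keys_add[of p q] unfolding bpoly_ring_def by auto
  have mult: "p * q \<in> ?C" if "p \<in> ?C" "q \<in> ?C" for p q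
  proof -
    have "Poly_Mapping.keys m \<subseteq> vars_upto n" if m: "m \<in> Poly_Mapping.keys (p * q)" for m
    proof -
      obtain a b where "m = a + b" "a \<in> Poly_Mapping.keys p" "b \<in> Poly_Mapping.keys q"
        using m keys_mult[of p q] by blast
      then show ?thesis
        using \<open>p \<in> ?C\<close> \<open>q \<in> ?C\<close> Poly_Mapping.keys_add[of a b]
        unfolding bpoly_ring_def by (simp, blast)
    qed
    then show ?thesis by (simp add: bpoly_ring_def)
  qed
  have neg: "- p \<in> ?C" if "p \<in> ?C" for p
    using that by (simp add: bpoly_ring_def)
  have zero: "0 \<in> ?C" and one: "1 \<in> ?C"
    by (simp_all add: bpoly_ring_def)
  have ops: "p \<otimes>\<^bsub>bpoly_ring n\<^esub> q = p * q" "p \<oplus>\<^bsub>bpoly_ring n\<^esub> q = p + q"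
    "\<one>\<^bsub>bpoly_ring n\<^esub> = 1" "\<zero>\<^bsub>bpoly_ring n\<^esub> = 0" for p q :: "'k bpoly"
    by (simp_all add: bpoly_ring_def)
  have "abelian_group (bpoly_ring n :: 'k bpoly ring)"
  proof (rule abelian_groupI, unfold ops)
    fix p assume "p \<in> ?C"
    then show "\<exists>q \<in> ?C. q + p = 0"
      by (intro bexI[OF _ neg[of p]]) simp
  qed (simp_all only: add zero ac_simps add_0_left add_0_right)
  moreover have "Group.comm_monoid (bpoly_ring n :: 'k bpoly ring)"
    by (rule comm_monoidI, unfold ops) (simp_all only: mult one ac_simps mult_1_left mult_1_right)
  ultimately show ?thesis
    by (rule cringI) (simp only: ops distrib_right)
qed

lemma var_gt_trans: "var_gt u v \<Longrightarrow> var_gt v w \<Longrightarrow> var_gt u w"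
  by (cases u; cases v; cases w) auto

lemma var_gt_irrefl: "\<not> var_gt v v"
  by (cases v) auto

lemma var_gt_total: "v \<noteq> w \<Longrightarrow> var_gt v w \<or> var_gt w v"
  by (cases v; cases w) auto

lemma lex_less_irrefl: "\<not> lex_less a a"
  by (simp add: lex_less_def)

lemma lex_less_trans:
  assumes "lex_less a b" "lex_less b c" shows "lex_less a c"
proof -
  obtain v where v: "Poly_Mapping.lookup a v < Poly_Mapping.lookup b v"
      "\<And>w. var_gt w v \<Longrightarrow> Poly_Mapping.lookup a w = Poly_Mapping.lookup b w"
    using assms(1) by (auto simp: lex_less_def)
  obtain u where u: "Poly_Mapping.lookup b u < Poly_Mapping.lookup c u"
      "\<And>w. var_gt w u \<Longrightarrow> Poly_Mapping.lookup b w = Poly_Mapping.lookup c w"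
    using assms(2) by (auto simp: lex_less_def)
  consider "u = v" | "var_gt u v" | "var_gt v u" using var_gt_total by blast
  then show ?thesis
  proof cases
    case 1
    with u v show ?thesis unfolding lex_less_def by (metis less_trans)
  next
    case 2
    with u v show ?thesis unfolding lex_less_def by (metis var_gt_trans)
  next
    case 3
    with u v show ?thesis unfolding lex_less_def by (metis var_gt_trans)
  qed
qed

lemma lex_less_total:
  assumes "a \<noteq> b" shows "lex_less a b \<or> lex_less b a"
proof -
  define D where "D = {v. Poly_Mapping.lookup a v \<noteq> Poly_Mapping.lookup b v}"
  have "D \<subseteq> Poly_Mapping.keys a \<union> Poly_Mapping.keys b"
    by (auto simp: D_def in_keys_iff)
  then have fin: "finite D" by (rule finite_subset) simp
  have ne: "D \<noteq> {}"
    using assms by (auto simp: D_def poly_mapping_eq_iff fun_eq_iff)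
  have "\<exists>v \<in> D. \<forall>w \<in> D. \<not> var_gt w v"
    using fin ne
  proof (induction D rule: finite_ne_induct)
    case (singleton v)
    then show ?case by (simp add: var_gt_irrefl)
  next
    case (insert v F)
    then obtain m where "m \<in> F" "\<forall>w \<in> F. \<not> var_gt w m" by blast
    then show ?case using var_gt_trans var_gt_irrefl by (metis insert_iff)
  qed
  then obtain v where v: "v \<in> D" "\<forall>w \<in> D. \<not> var_gt w v" by blast
  have "\<forall>w. var_gt w v \<longrightarrow> Poly_Mapping.lookup a w = Poly_Mapping.lookup b w"
    using v(2) by (auto simp: D_def)
  moreover have "Poly_Mapping.lookup a v < Poly_Mapping.lookup b v \<or>
      Poly_Mapping.lookup b v < Poly_Mapping.lookup a v"
    using v(1) by (auto simp: D_def)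
  ultimately show ?thesis unfolding lex_less_def by metis
qed

lemma lead_mon_unique:
  assumes "p \<noteq> 0"
  shows "\<exists>!m. m \<in> Poly_Mapping.keys p \<and>
    (\<forall>m' \<in> Poly_Mapping.keys p. m' \<noteq> m \<longrightarrow> lex_less m' m)"
proof -
  have "\<exists>m \<in> A. \<forall>m' \<in> A. m' \<noteq> m \<longrightarrow> lex_less m' m"
    if "finite A" "A \<noteq> {}" for A
    using that
  proof (induction A rule: finite_ne_induct)
    case (singleton v)
    then show ?case by simp
  next
    case (insert v F)
    then obtain m where "m \<in> F" "\<forall>m' \<in> F. m' \<noteq> m \<longrightarrow> lex_less m' m" by blast
    then show ?case using lex_less_trans lex_less_total by (metis insert_iff)
  qed
  from this[of "Poly_Mapping.keys p"] assms obtain m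
    where m: "m \<in> Poly_Mapping.keys p" "\<forall>m' \<in> Poly_Mapping.keys p. m' \<noteq> m \<longrightarrow> lex_less m' m"
    by auto
  show ?thesis
  proof (rule ex1I[of _ m])
    fix m' assume "m' \<in> Poly_Mapping.keys p \<and>
      (\<forall>m'' \<in> Poly_Mapping.keys p. m'' \<noteq> m' \<longrightarrow> lex_less m'' m')"
    then show "m' = m"
      using m lex_less_trans[of m m' m] lex_less_irrefl[of m] by metis
  qed (use m in blast)
qed

end

theory Submission
  imports Defs
begin

text \<open>
  Let \<open>F\<close> be a facet of the simplicial complex of the squarefree ideal \<open>in(J)\<close> and \<open>V\<close> the complementary
  set of variables, so that \<open>(V)\<close> is a minimal prime of \<open>in(J)\<close>. An explicit substitution \<open>\<phi>\<close> maps \<open>J\<close> into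
  \<open>(V)\<close>, and \<open>P = \<phi>\<^sup>-\<^sup>1((V))\<close> is a minimal prime of \<open>J\<close>. The substitution is unitriangular for the
  lexicographic order, so \<open>\<phi>(f) \<in> (V)\<^sup>k\<close> forces the leading monomial of \<open>f\<close> to lie in \<open>(V)\<^sup>k\<close>; since
  \<open>(V)\<close>-adic order is a valuation, this applies to every \<open>f\<close> in the symbolic power of \<open>J\<close>. If \<open>in(J)\<close> is
  normally torsion-free, then \<open>in(J)\<^sup>k\<close> is the intersection of the ideals \<open>(V)\<^sup>k\<close>, hence contains the leading
  monomials of the symbolic power. As \<open>in(J)\<^sup>k\<close> is contained in the initial ideal of \<open>J\<^sup>k\<close>, the two powers coincide.
\<close>

text \<open>The substitutions themselves determine the initial ideal: if the support of a leading
  monomial of \<open>J\<close> were a face, it would lie in some facet, and the substitution of that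
  facet would force a variable outside the facet into the monomial. Conversely, suitable monomial
  multiples of minors along paths realise every monomial whose support is not a face.
  Torsion-freeness is used on one colon ideal at a time: a monomial outside in(J)^k has a multiple
  whose colon ideal is generated by a set \<open>V\<close> of variables. The prime (V) is then
  associated to in(J)^k, hence to in(J), and this makes the complement of \<open>V\<close> a facet.
  So the minimal primes of \<open>J\<close> that come from facets are the only ones against which
  the symbolic power is tested.\<close>

abbreviation supp :: "('a \<Rightarrow>\<^sub>0 'b::zero) \<Rightarrow> 'a set" where
  "supp \<equiv> Poly_Mapping.keys"

abbreviation cf :: "('a \<Rightarrow>\<^sub>0 'b::zero) \<Rightarrow> 'a \<Rightarrow> 'b" where
  "cf \<equiv> Poly_Mapping.lookup"

abbreviation mterm :: "'a \<Rightarrow> 'b::zero \<Rightarrow> ('a \<Rightarrow>\<^sub>0 'b)" where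
  "mterm \<equiv> Poly_Mapping.single"

section \<open>Polynomials over an ordered monoid of monomials\<close>

lemma supp_add_nat: "supp (a + b) = supp a \<union> supp b" for a b :: "'a \<Rightarrow>\<^sub>0 nat"
  by (auto simp: in_keys_iff lookup_add)

lemma sum_mterm: "p = (\<Sum>m\<in>supp p. mterm m (cf p m))"
  by (rule poly_mapping_eqI)
     (auto simp: lookup_sum lookup_single when_def sum.delta in_keys_iff)

lemma poly_induct [case_names zero single add]:
  fixes p :: "'a \<Rightarrow>\<^sub>0 'b::comm_monoid_add"
  assumes "P 0" "\<And>m c. P (mterm m c)" "\<And>p q. P p \<Longrightarrow> P q \<Longrightarrow> P (p + q)"
  shows "P p"
proof -
  have "P (\<Sum>m\<in>A. mterm m (cf p m))" if "finite A" for A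
    using that by (induction A rule: finite_induct) (auto intro: assms)
  from this[of "supp p"] show ?thesis using sum_mterm[of p] by simp
qed

lemma cf_const_mult: "cf (mterm 0 c * p) x = c * cf p x" for p :: "'a::comm_monoid_add \<Rightarrow>\<^sub>0 'b::comm_ring_1"
  by (induction p rule: poly_induct) (auto simp: mult_single lookup_single when_def distrib_left lookup_add)

lemma cf_mult_mterm: "cf (p * mterm m c) (a + m) = cf p a * c"
  for p :: "'a::cancel_comm_monoid_add \<Rightarrow>\<^sub>0 'b::comm_ring_1"
  by (induction p rule: poly_induct) (auto simp: mult_single lookup_single when_def distrib_right lookup_add)

lemma supp_mult_mterm: "supp (p * mterm m 1) = (\<lambda>a. a + m) ` supp p"
  for p :: "'a::cancel_comm_monoid_add \<Rightarrow>\<^sub>0 'b::comm_ring_1"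
proof
  show "supp (p * mterm m 1) \<subseteq> (\<lambda>a. a + m) ` supp p"
    using keys_mult[of p "mterm m 1"] by auto
  show "(\<lambda>a. a + m) ` supp p \<subseteq> supp (p * mterm m 1)"
    by (auto simp: in_keys_iff cf_mult_mterm)
qed

text \<open>The axioms leave room for orders that are not well-founded: one instance ranks a
  monomial higher the smaller its degree in a set of variables. Finite supports still provide a
  largest monomial.\<close>

locale monomial_order =
  fixes lt :: "'a::cancel_comm_monoid_add \<Rightarrow> 'a \<Rightarrow> bool"
  assumes irrefl: "\<not> lt a a"
    and trans: "lt a b \<Longrightarrow> lt b c \<Longrightarrow> lt a c"
    and total: "a \<noteq> b \<Longrightarrow> lt a b \<or> lt b a"
    and add_mono: "lt a b \<Longrightarrow> lt (a + c) (b + c)"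
begin

definition below :: "('a \<Rightarrow>\<^sub>0 'b::zero) \<Rightarrow> 'a \<Rightarrow> bool" where
  "below p a \<longleftrightarrow> (\<forall>m\<in>supp p. m = a \<or> lt m a)"

lemma ex_top:
  assumes "p \<noteq> 0" obtains a where "a \<in> supp p" "below p a"
proof -
  have "\<exists>m \<in> A. \<forall>m' \<in> A. m' = m \<or> lt m' m" if "finite A" "A \<noteq> {}" for A
    using that
  proof (induction A rule: finite_ne_induct)
    case (insert v F)
    then obtain m where "m \<in> F" "\<forall>m' \<in> F. m' = m \<or> lt m' m" by blast
    then show ?case using trans total by (metis insert_iff)
  qed simp
  from this[of "supp p"] assms that show ?thesis by (auto simp: below_def)
qed

text \<open>Once the terms at \<open>a\<close> and \<open>b\<close> are split off, every other
  product of monomials is strictly below \<open>a + b\<close>. Here \<open>a\<close> and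
  \<open>b\<close> are only upper bounds, so the coefficient formula also covers vanishing
  coefficients.\<close>

lemma top_mult:
  fixes p q :: "'a \<Rightarrow>\<^sub>0 'b::comm_ring_1"
  assumes p: "below p a" and q: "below q b"
  shows "below (p * q) (a + b)" "cf (p * q) (a + b) = cf p a * cf q b"
proof -
  define p' where "p' = p - mterm a (cf p a)"
  define q' where "q' = q - mterm b (cf q b)"
  have p': "lt m a" if "m \<in> supp p'" for m
    using that p by (auto simp: p'_def below_def in_keys_iff lookup_minus lookup_single when_def split: if_splits)
  have q': "lt m b" if "m \<in> supp q'" for m
    using that q by (auto simp: q'_def below_def in_keys_iff lookup_minus lookup_single when_def split: if_splits)
  have eq: "p * q = mterm (a + b) (cf p a * cf q b) + (mterm a (cf p a) * q' + p' * q)"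
    by (simp add: p'_def q'_def algebra_simps mult_single)
  have lt: "lt m (a + b)" if "m \<in> supp (mterm a (cf p a) * q' + p' * q)" for m
  proof -
    from that consider "m \<in> supp (mterm a (cf p a) * q')" | "m \<in> supp (p' * q)"
      using Poly_Mapping.keys_add[of "mterm a (cf p a) * q'" "p' * q"] by blast
    then show ?thesis
    proof cases
      case 1
      then obtain c where "c \<in> supp q'" "m = a + c"
        using keys_mult[of "mterm a (cf p a)" q'] by (auto split: if_splits)
      then show ?thesis using add_mono[OF q', of c a] by (simp add: add.commute)
    next
      case 2
      then obtain c d where cd: "c \<in> supp p'" "d \<in> supp q" "m = c + d"
        using keys_mult[of p' q] by blast
      have "lt (c + d) (a + d)" using add_mono[OF p'] cd by blast
      moreover have "d = b \<or> lt (a + d) (a + b)"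
        using q cd(2) add_mono[of d b a] by (auto simp: below_def add.commute)
      ultimately show ?thesis using cd(3) trans by blast
    qed
  qed
  show "below (p * q) (a + b)"
    unfolding below_def
  proof
    fix m assume "m \<in> supp (p * q)"
    then have "m \<in> supp (mterm (a + b) (cf p a * cf q b)) \<or> m \<in> supp (mterm a (cf p a) * q' + p' * q)"
      unfolding eq using Poly_Mapping.keys_add[of "mterm (a + b) (cf p a * cf q b)"] by blast
    then show "m = a + b \<or> lt m (a + b)"
      using lt by (auto split: if_splits)
  qed
  have "a + b \<notin> supp (mterm a (cf p a) * q' + p' * q)"
    using lt irrefl by blast
  then have "cf (mterm a (cf p a) * q' + p' * q) (a + b) = 0"
    by (simp only: in_keys_iff not_not)
  then show "cf (p * q) (a + b) = cf p a * cf q b"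
    by (subst eq) (simp only: lookup_add lookup_single_eq add_0_right)
qed

end

section \<open>Lexicographic leading monomials\<close>

interpretation lex: monomial_order lex_less
proof
  show "lex_less (a + c) (b + c)" if "lex_less a b" for a b c :: bmon
    using that by (auto simp: lex_less_def lookup_add)
qed (use lex_less_irrefl lex_less_trans lex_less_total in blast)+

lemma lead_mon:
  assumes "p \<noteq> 0"
  shows "lead_mon p \<in> supp p" "lex.below p (lead_mon p)"
  using theI'[OF lead_mon_unique[OF assms], folded lead_mon_def] by (auto simp: lex.below_def)

lemma lead_monI:
  assumes "m \<in> supp p" "lex.below p m"
  shows "lead_mon p = m"
proof -
  have "p \<noteq> 0" using assms(1) by auto
  from lead_mon[OF this] assms show ?thesis
    unfolding lex.below_def using lex_less_trans lex_less_irrefl by metis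
qed

text \<open>With infinitely many variables x_1 > x_2 > ... would descend forever. For finitely many,
  the exponents listed from the largest variable down form lists of a fixed length, on which the
  lexicographic order is well-founded.\<close>

lemma wf_lex: "wf {(a, b). supp a \<subseteq> vars_upto n \<and> supp b \<subseteq> vars_upto n \<and> lex_less a b}"
proof -
  define vs where "vs = map X_var [1..<Suc n] @ map Y_var [1..<Suc n]"
  define f where "f a = map (cf a) vs" for a :: bmon
  have set: "set vs = vars_upto n"
    by (auto simp: vs_def vars_upto_def)
  have sorted: "sorted_wrt var_gt vs"
    by (auto simp: vs_def sorted_wrt_append sorted_wrt_map)
  have "(f a, f b) \<in> lexn less_than (length vs)"
    if ab: "supp a \<subseteq> vars_upto n" "supp b \<subseteq> vars_upto n" "lex_less a b" for a b
  proof -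
    obtain v where v: "cf a v < cf b v" "\<And>w. var_gt w v \<Longrightarrow> cf a w = cf b w"
      using ab(3) by (auto simp: lex_less_def)
    then have "v \<in> set vs" using ab(2) set by (auto simp: in_keys_iff)
    then obtain us ws where us: "vs = us @ v # ws" by (meson split_list)
    have "map (cf a) us = map (cf b) us"
      using sorted us v(2) by (auto simp: sorted_wrt_append)
    then show ?thesis
      unfolding lexn_conv
      using v(1) by (auto simp: f_def us intro!: exI[of _ "map (cf b) us"])
  qed
  then have "{(a, b). supp a \<subseteq> vars_upto n \<and> supp b \<subseteq> vars_upto n \<and> lex_less a b}
      \<subseteq> inv_image (lexn less_than (length vs)) f"
    by auto
  then show ?thesis
    by (rule wf_subset[OF wf_inv_image[OF wf_lexn[OF wf_less_than]]])
qed

section \<open>Substitution homomorphisms\<close>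

definition subst_mono :: "('a \<Rightarrow> 'b::comm_ring_1) \<Rightarrow> ('a \<Rightarrow>\<^sub>0 nat) \<Rightarrow> 'b" where
  "subst_mono \<sigma> m = (\<Prod>v\<in>supp m. \<sigma> v ^ cf m v)"

definition subst :: "('v \<Rightarrow> ('b::comm_monoid_add \<Rightarrow>\<^sub>0 'k::comm_ring_1)) \<Rightarrow> (('v \<Rightarrow>\<^sub>0 nat) \<Rightarrow>\<^sub>0 'k) \<Rightarrow> ('b \<Rightarrow>\<^sub>0 'k)" where
  "subst \<sigma> p = (\<Sum>m\<in>supp p. mterm 0 (cf p m) * subst_mono \<sigma> m)"

lemma subst_mono_superset:
  "finite A \<Longrightarrow> supp m \<subseteq> A \<Longrightarrow> subst_mono \<sigma> m = (\<Prod>v\<in>A. \<sigma> v ^ cf m v)"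
  unfolding subst_mono_def by (rule prod.mono_neutral_left) (auto simp: in_keys_iff)

lemma subst_mono_add: "subst_mono \<sigma> (a + b) = subst_mono \<sigma> a * subst_mono \<sigma> b"
proof -
  have "subst_mono \<sigma> x = (\<Prod>v\<in>supp a \<union> supp b. \<sigma> v ^ cf x v)" if "x \<in> {a, b, a + b}" for x
    using that by (intro subst_mono_superset) (auto simp: supp_add_nat)
  then show ?thesis by (simp add: lookup_add power_add prod.distrib)
qed

lemma subst_mono_0 [simp]: "subst_mono \<sigma> 0 = 1"
  by (simp add: subst_mono_def)

lemma subst_mono_var: "subst_mono \<sigma> (mterm v 1) = \<sigma> v"
  by (simp add: subst_mono_def)

lemma subst_superset:
  "finite A \<Longrightarrow> supp p \<subseteq> A \<Longrightarrow> subst \<sigma> p = (\<Sum>m\<in>A. mterm 0 (cf p m) * subst_mono \<sigma> m)"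
  unfolding subst_def by (rule sum.mono_neutral_left) (auto simp: in_keys_iff)

lemma subst_add: "subst \<sigma> (p + q) = subst \<sigma> p + subst \<sigma> q"
proof -
  have "subst \<sigma> x = (\<Sum>m\<in>supp p \<union> supp q. mterm 0 (cf x m) * subst_mono \<sigma> m)"
    if "x \<in> {p, q, p + q}" for x
    using that Poly_Mapping.keys_add[of p q] by (intro subst_superset) auto
  then show ?thesis by (simp add: lookup_add single_add distrib_right sum.distrib)
qed

lemma subst_0 [simp]: "subst \<sigma> 0 = 0"
  by (simp add: subst_def)

lemma subst_single: "subst \<sigma> (mterm m c) = mterm 0 c * subst_mono \<sigma> m"
  by (simp add: subst_def)

lemma subst_uminus: "subst \<sigma> (- p) = - subst \<sigma> p"
  using subst_add[of \<sigma> p "- p"] by (simp add: eq_neg_iff_add_eq_0 add.commute)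

lemma subst_diff: "subst \<sigma> (p - q) = subst \<sigma> p - subst \<sigma> q"
  using subst_add[of \<sigma> p "- q"] by (simp add: subst_uminus)

lemma subst_mult: "subst \<sigma> (p * q) = subst \<sigma> p * subst \<sigma> q"
proof (induction p rule: poly_induct)
  case (single m c)
  show ?case
  proof (induction q rule: poly_induct)
    case (single m' d)
    have "mterm 0 (c * d) = mterm 0 c * mterm 0 d" by (simp add: mult_single)
    then have "subst \<sigma> (mterm m c * mterm m' d) = mterm 0 c * mterm 0 d * (subst_mono \<sigma> m * subst_mono \<sigma> m')"
      by (simp add: mult_single subst_single subst_mono_add)
    then show ?case by (simp only: subst_single ac_simps)
  qed (simp_all add: distrib_left subst_add)
qed (simp_all add: distrib_right subst_add)

section \<open>Ideals of the polynomial ring\<close>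

definition bmons :: "nat \<Rightarrow> bmon set" where
  "bmons n = {m. supp m \<subseteq> vars_upto n}"

lemma mterm_eq_0_iff [simp]: "mterm m c = 0 \<longleftrightarrow> c = 0"
  by (metis lookup_single_eq lookup_zero single_zero)

lemma finite_vars_upto [simp]: "finite (vars_upto n)"
  by (simp add: vars_upto_def)

lemma bmons_0 [simp]: "0 \<in> bmons n"
  by (simp add: bmons_def)

lemma bmons_add [simp]: "a + b \<in> bmons n \<longleftrightarrow> a \<in> bmons n \<and> b \<in> bmons n"
  by (simp add: bmons_def supp_add_nat)

lemma bmons_var [simp]: "mterm v (Suc 0) \<in> bmons n \<longleftrightarrow> v \<in> vars_upto n"
  by (simp add: bmons_def)

lemma ring_ops [simp]:
  "p \<otimes>\<^bsub>bpoly_ring n\<^esub> q = p * q" "p \<oplus>\<^bsub>bpoly_ring n\<^esub> q = p + q"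
  "\<one>\<^bsub>bpoly_ring n\<^esub> = 1" "\<zero>\<^bsub>bpoly_ring n\<^esub> = 0"
  by (simp_all add: bpoly_ring_def)

lemma carrier_iff: "p \<in> carrier (bpoly_ring n) \<longleftrightarrow> supp p \<subseteq> bmons n"
  by (auto simp: bpoly_ring_def bmons_def)

lemma carrier_mult: "(p :: 'k::field bpoly) \<in> carrier (bpoly_ring n) \<Longrightarrow> q \<in> carrier (bpoly_ring n) \<Longrightarrow> p * q \<in> carrier (bpoly_ring n)"
  using monoid.m_closed[of "bpoly_ring n" p q] cring_bpoly_ring[of n, where 'k = 'k]
  by (simp add: cring_def comm_monoid_def)

lemma carrier_add: "p \<in> carrier (bpoly_ring n) \<Longrightarrow> q \<in> carrier (bpoly_ring n) \<Longrightarrow> p + q \<in> carrier (bpoly_ring n)"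
  using Poly_Mapping.keys_add[of p q] by (auto simp: carrier_iff)

lemma carrier_mterm: "m \<in> bmons n \<Longrightarrow> mterm m c \<in> carrier (bpoly_ring n)"
  by (auto simp: carrier_iff)

lemma carrier_uminus: "p \<in> carrier (bpoly_ring n) \<Longrightarrow> - p \<in> carrier (bpoly_ring n)"
  by (simp add: carrier_iff)

lemma carrier_diff: "p \<in> carrier (bpoly_ring n) \<Longrightarrow> q \<in> carrier (bpoly_ring n) \<Longrightarrow> p - q \<in> carrier (bpoly_ring n)"
  using carrier_add[OF _ carrier_uminus, of p n q] by simp

lemma bideal_I:
  assumes "I \<subseteq> carrier (bpoly_ring n)" "0 \<in> I" "\<And>p q. p \<in> I \<Longrightarrow> q \<in> I \<Longrightarrow> p + q \<in> I"
    "\<And>a p. a \<in> carrier (bpoly_ring n) \<Longrightarrow> p \<in> I \<Longrightarrow> a * p \<in> I"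
  shows "ideal I (bpoly_ring n :: 'k::field bpoly ring)"
proof (rule idealI)
  interpret cring "bpoly_ring n :: 'k bpoly ring" by (rule cring_bpoly_ring)
  show "ring (bpoly_ring n :: 'k bpoly ring)" by (rule ring_axioms)
  show "subgroup I (add_monoid (bpoly_ring n))"
  proof (rule add.subgroupI)
    fix p assume p: "p \<in> I"
    then have "- 1 * p \<in> I"
      using assms(4)[OF carrier_uminus, of 1 p] by (simp add: carrier_iff)
    moreover have "\<ominus>\<^bsub>bpoly_ring n\<^esub> p = - p"
      using p assms(1) carrier_uminus[of p n] by (intro minus_equality) auto
    ultimately show "\<ominus>\<^bsub>bpoly_ring n\<^esub> p \<in> I" by simp
  qed (use assms in auto)
  fix p a assume "p \<in> I" "a \<in> carrier (bpoly_ring n :: 'k bpoly ring)"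
  then show "a \<otimes>\<^bsub>bpoly_ring n\<^esub> p \<in> I" "p \<otimes>\<^bsub>bpoly_ring n\<^esub> a \<in> I"
    using assms(4)[of a p] by (simp_all add: mult.commute)
qed

lemma bideal:
  assumes "ideal I (bpoly_ring n :: 'k::field bpoly ring)"
  shows bideal_carrier: "p \<in> I \<Longrightarrow> p \<in> carrier (bpoly_ring n)"
    and bideal_0: "0 \<in> I"
    and bideal_add: "p \<in> I \<Longrightarrow> q \<in> I \<Longrightarrow> p + q \<in> I"
    and bideal_mult: "a \<in> carrier (bpoly_ring n) \<Longrightarrow> p \<in> I \<Longrightarrow> a * p \<in> I"
    and bideal_diff: "p \<in> I \<Longrightarrow> q \<in> I \<Longrightarrow> p - q \<in> I"
proof -
  interpret ideal I "bpoly_ring n :: 'k bpoly ring" by fact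
  show "p \<in> carrier (bpoly_ring n)" if "p \<in> I" using that by (rule Icarr)
  show "0 \<in> I" using additive_subgroup.zero_closed[OF is_additive_subgroup] by simp
  show add: "p + q \<in> I" if "p \<in> I" "q \<in> I" for p q
    using additive_subgroup.a_closed[OF is_additive_subgroup that] by simp
  show mult: "a * p \<in> I" if "a \<in> carrier (bpoly_ring n)" "p \<in> I" for a p
    using I_l_closed[OF that(2,1)] by simp
  show "p - q \<in> I" if "p \<in> I" "q \<in> I"
    using add[OF that(1) mult[OF _ that(2), of "- 1"]] by (simp add: carrier_iff)
qed

lemma bideal_span:
  assumes "ideal I (bpoly_ring n :: 'k::field bpoly ring)" "\<And>m. m \<in> supp p \<Longrightarrow> mterm m 1 \<in> I" "p \<in> carrier (bpoly_ring n)"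
  shows "p \<in> I"
proof -
  have "(\<Sum>m\<in>A. mterm m (cf p m)) \<in> I" if "finite A" "A \<subseteq> supp p" for A
    using that
  proof (induction A rule: finite_induct)
    case (insert m A)
    have "mterm 0 (cf p m) * mterm m 1 \<in> I"
      using insert.prems assms(2) by (intro bideal_mult[OF assms(1)]) (auto simp: carrier_iff)
    then show ?case
      using insert by (simp add: mult_single bideal_add[OF assms(1)])
  qed (simp add: bideal_0[OF assms(1)])
  from this[of "supp p"] show ?thesis using sum_mterm[of p] by simp
qed

section \<open>Monomial ideals as sets of exponents\<close>

definition upset :: "nat \<Rightarrow> bmon set \<Rightarrow> bool" where
  "upset n A \<longleftrightarrow> A \<subseteq> bmons n \<and> (\<forall>a\<in>A. \<forall>b\<in>bmons n. a + b \<in> A)"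

lemma upset_add: "upset n A \<Longrightarrow> a \<in> A \<Longrightarrow> b \<in> bmons n \<Longrightarrow> a + b \<in> A"
  by (simp add: upset_def)

definition mono_ideal :: "bmon set \<Rightarrow> 'k::field bpoly set" where
  "mono_ideal A = {p. supp p \<subseteq> A}"

lemma mterm_mono_ideal [simp]: "mterm m 1 \<in> mono_ideal A \<longleftrightarrow> m \<in> A"
  by (simp add: mono_ideal_def)

lemma ideal_mono_ideal:
  assumes "upset n A" shows "ideal (mono_ideal A) (bpoly_ring n)"
proof (rule bideal_I)
  fix a p :: "'a bpoly" assume a: "a \<in> carrier (bpoly_ring n)" and p: "p \<in> mono_ideal A"
  show "a * p \<in> mono_ideal A"
    unfolding mono_ideal_def
  proof safe
    fix m assume "m \<in> supp (a * p)"
    then obtain c d where "c \<in> supp a" "d \<in> supp p" "m = c + d"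
      using keys_mult[of a p] by blast
    then show "m \<in> A"
      using assms a p unfolding upset_def mono_ideal_def carrier_iff by (metis (lifting) add.commute mem_Collect_eq subsetD)
  qed
next
  fix p q :: "'a bpoly" assume "p \<in> mono_ideal A" "q \<in> mono_ideal A"
  then show "p + q \<in> mono_ideal A"
    using Poly_Mapping.keys_add[of p q] by (auto simp: mono_ideal_def)
qed (use assms in \<open>auto simp: mono_ideal_def carrier_iff upset_def\<close>)

lemma ideal_prod_bideal: "ideal I (bpoly_ring n) \<Longrightarrow> ideal I' (bpoly_ring n) \<Longrightarrow>
    ideal (ideal_prod (bpoly_ring n) I I') (bpoly_ring n :: 'k::field bpoly ring)"
  by (rule ring.ideal_prod_is_ideal[OF cring.axioms(1)[OF cring_bpoly_ring]])

lemma ideal_prod_mono_ideal: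
  assumes "upset n A" "upset n B"
  shows "ideal_prod (bpoly_ring n) (mono_ideal A) (mono_ideal B :: 'k::field bpoly set) =
    mono_ideal {a + b | a b. a \<in> A \<and> b \<in> B}" (is "?L = mono_ideal ?C")
proof
  have AB: "A \<subseteq> bmons n" "B \<subseteq> bmons n"
    using assms by (auto simp: upset_def)
  show "?L \<subseteq> mono_ideal ?C"
  proof
    fix p assume "p \<in> ?L"
    then show "p \<in> mono_ideal ?C"
    proof induction
      case (prod p q)
      then have "supp p \<subseteq> A" "supp q \<subseteq> B" by (auto simp: mono_ideal_def)
      then show ?case using keys_mult[of p q] by (fastforce simp: mono_ideal_def)
    next
      case (sum p q)
      then show ?case using Poly_Mapping.keys_add[of p q] by (fastforce simp: mono_ideal_def)
    qed
  qed
  show "mono_ideal ?C \<subseteq> ?L"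
  proof
    fix p :: "'k bpoly" assume p: "p \<in> mono_ideal ?C"
    show "p \<in> ?L"
    proof (rule bideal_span[OF ideal_prod_bideal[OF ideal_mono_ideal ideal_mono_ideal]])
      show "upset n A" "upset n B" by fact+
      show "p \<in> carrier (bpoly_ring n)"
        using p AB by (auto simp: carrier_iff mono_ideal_def subset_iff)
      fix m assume "m \<in> supp p"
      then obtain a b where "m = a + b" "a \<in> A" "b \<in> B" using p by (auto simp: mono_ideal_def)
      then show "mterm m 1 \<in> ?L"
        using ideal_prod.prod[of "mterm a 1" "mono_ideal A" "mterm b 1" "mono_ideal B" "bpoly_ring n"]
        by (simp add: mult_single)
    qed
  qed
qed

text \<open>Exponent set of a power of a monomial ideal. It starts from all of
  \<open>bmons n\<close> because the empty product of ideals is the whole ring.\<close>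

fun mpow :: "nat \<Rightarrow> bmon set \<Rightarrow> nat \<Rightarrow> bmon set" where
  "mpow n A 0 = bmons n"
| "mpow n A (Suc k) = {a + b | a b. a \<in> mpow n A k \<and> b \<in> A}"

lemma upset_mpow: "upset n A \<Longrightarrow> upset n (mpow n A k)"
proof (induction k)
  case (Suc k)
  have "a + b + c \<in> mpow n A (Suc k)" if "a \<in> mpow n A k" "b \<in> A" "c \<in> bmons n" for a b c
    using that Suc.prems unfolding mpow.simps upset_def by (metis (mono_tags, lifting) add.assoc mem_Collect_eq)
  moreover have "mpow n A (Suc k) \<subseteq> bmons n"
    using Suc by (auto simp: upset_def)
  ultimately show ?case unfolding upset_def by auto
qed (auto simp: upset_def)

lemma ideals_set_ops [simp]: "\<one>\<^bsub>ideals_set R\<^esub> = carrier R" "I \<otimes>\<^bsub>ideals_set R\<^esub> I' = ideal_prod R I I'"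
  by (simp_all add: ideals_set_def)

lemma ideal_ideal_power:
  "ideal I (bpoly_ring n) \<Longrightarrow> ideal (ideal_power (bpoly_ring n) I k) (bpoly_ring n :: 'k::field bpoly ring)"
  by (induction k) (auto intro: ideal_prod_bideal ring.oneideal cring.axioms(1) cring_bpoly_ring)

lemma ideal_power_mono_ideal:
  assumes "upset n A"
  shows "ideal_power (bpoly_ring n) (mono_ideal A) k = mono_ideal (mpow n A k)"
proof (induction k)
  case 0
  show ?case by (auto simp: mono_ideal_def carrier_iff)
next
  case (Suc k)
  then show ?case by (simp add: ideal_prod_mono_ideal[OF upset_mpow[OF assms] assms])
qed

section \<open>Leading monomials and initial ideals\<close>

definition LM :: "'k::field bpoly set \<Rightarrow> bmon set" where
  "LM I = lead_mon ` (I - {0})"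

lemma lead_mon_mult:
  fixes p q :: "'k::field bpoly"
  assumes "p \<noteq> 0" "q \<noteq> 0"
  shows "p * q \<noteq> 0" "lead_mon (p * q) = lead_mon p + lead_mon q"
proof -
  note pq = lex.top_mult[OF lead_mon(2)[OF assms(1)] lead_mon(2)[OF assms(2)]]
  have key: "lead_mon p + lead_mon q \<in> supp (p * q)"
    using pq(2) lead_mon(1)[OF assms(1)] lead_mon(1)[OF assms(2)] by (auto simp: in_keys_iff)
  then show "p * q \<noteq> 0" by auto
  show "lead_mon (p * q) = lead_mon p + lead_mon q"
    by (rule lead_monI[OF key pq(1)])
qed

lemma lead_mon_mterm: "c \<noteq> 0 \<Longrightarrow> lead_mon (mterm m c) = m"
  by (rule lead_monI) (auto simp: lex.below_def)

lemma upset_LM: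
  assumes "ideal I (bpoly_ring n :: 'k::field bpoly ring)"
  shows "upset n (LM I)"
  unfolding upset_def
proof safe
  fix a assume a: "a \<in> LM I"
  then obtain p where p: "p \<in> I" "p \<noteq> 0" "a = lead_mon p" by (auto simp: LM_def)
  then show "a \<in> bmons n"
    using lead_mon(1) bideal_carrier[OF assms] by (auto simp: carrier_iff)
  fix b assume b: "b \<in> bmons n"
  have "mterm b 1 * p \<in> I - {0}"
    using p b lead_mon_mult(1)[of "mterm b 1" p] by (auto intro!: bideal_mult[OF assms] carrier_mterm)
  moreover have "lead_mon (mterm b 1 * p) = a + b"
    using p lead_mon_mult(2)[of "mterm b 1" p] by (simp add: lead_mon_mterm add.commute)
  ultimately show "a + b \<in> LM I" unfolding LM_def by (metis image_eqI)
qed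

lemma initial_ideal_eq:
  assumes "ideal I (bpoly_ring n :: 'k::field bpoly ring)"
  shows "initial_ideal n I = mono_ideal (LM I)"
proof
  interpret cring "bpoly_ring n :: 'k bpoly ring" by (rule cring_bpoly_ring)
  let ?G = "{mterm (lead_mon f) 1 | f. f \<in> I \<and> f \<noteq> 0} :: 'k bpoly set"
  note up = upset_LM[OF assms]
  have G: "?G \<subseteq> mono_ideal (LM I)" by (auto simp: LM_def)
  show "initial_ideal n I \<subseteq> mono_ideal (LM I)"
    unfolding initial_ideal_def by (rule genideal_minimal[OF ideal_mono_ideal[OF up] G])
  have Gc: "?G \<subseteq> carrier (bpoly_ring n)"
    using G ideal.Icarr[OF ideal_mono_ideal[OF up]] by blast
  show "mono_ideal (LM I) \<subseteq> initial_ideal n I"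
  proof
    fix p :: "'k bpoly" assume p: "p \<in> mono_ideal (LM I)"
    show "p \<in> initial_ideal n I"
      unfolding initial_ideal_def
    proof (rule bideal_span[OF genideal_ideal[OF Gc]])
      show "p \<in> carrier (bpoly_ring n)" using p ideal.Icarr[OF ideal_mono_ideal[OF up]] by blast
      fix m assume "m \<in> supp p"
      then have "mterm m 1 \<in> ?G" using p by (auto simp: mono_ideal_def LM_def)
      then show "mterm m 1 \<in> Idl\<^bsub>bpoly_ring n\<^esub> ?G" using genideal_self[OF Gc] by blast
    qed
  qed
qed

lemma mpow_LM_subset:
  assumes "ideal I (bpoly_ring n :: 'k::field bpoly ring)"
  shows "mpow n (LM I) k \<subseteq> LM (ideal_power (bpoly_ring n) I k)"
proof (induction k)
  case 0
  have "m \<in> LM (carrier (bpoly_ring n) :: 'k bpoly set)" if "m \<in> bmons n" for m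
    unfolding LM_def using that
    by (intro image_eqI[of _ _ "mterm m 1"]) (auto simp: lead_mon_mterm carrier_iff)
  then show ?case by auto
next
  case (Suc k)
  show ?case
  proof
    fix m assume "m \<in> mpow n (LM I) (Suc k)"
    then obtain p q where "m = lead_mon p + lead_mon q" "p \<in> ideal_power (bpoly_ring n) I k" "p \<noteq> 0"
        "q \<in> I" "q \<noteq> 0"
      using Suc by (fastforce simp: LM_def)
    then show "m \<in> LM (ideal_power (bpoly_ring n) I (Suc k))"
      unfolding LM_def using lead_mon_mult[of p q] ideal_prod.prod[of p _ q I "bpoly_ring n"]
      by (intro image_eqI[of _ _ "p * q"]) auto
  qed
qed

text \<open>The division argument: from \<open>f\<close> in \<open>N\<close> subtract a scalar
  multiple of an element of \<open>I\<close> with the same leading monomial. The difference stays in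
  \<open>N\<close> and is 0 or has a smaller leading monomial.\<close>

lemma eq_if_LM_subset:
  assumes I: "ideal I (bpoly_ring n :: 'k::field bpoly ring)" and N: "ideal N (bpoly_ring n)"
    and "I \<subseteq> N" "LM N \<subseteq> LM I"
  shows "N = I"
proof -
  have "f \<in> N \<longrightarrow> f \<noteq> 0 \<longrightarrow> lead_mon f = m \<longrightarrow> f \<in> I" for f m
  proof (induction m arbitrary: f rule: wf_induct_rule[OF wf_lex[of n]])
    case (1 m)
    show ?case
    proof safe
      assume f: "f \<in> N" "f \<noteq> 0" and m: "m = lead_mon f"
      then obtain g where g: "g \<in> I" "g \<noteq> 0" "lead_mon g = m"
        using \<open>LM N \<subseteq> LM I\<close> by (force simp: LM_def)
      define h where "h = f - mterm 0 (cf f m / cf g m) * g"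
      have gm: "cf g m \<noteq> 0" using lead_mon(1)[OF g(2)] g(3) by (simp add: in_keys_iff)
      have cg: "mterm 0 (cf f m / cf g m) * g \<in> I"
        using g by (intro bideal_mult[OF I]) (auto simp: carrier_iff)
      have hN: "h \<in> N" unfolding h_def using f cg \<open>I \<subseteq> N\<close> by (intro bideal_diff[OF N]) auto
      have "h \<in> I"
      proof (cases "h = 0")
        case False
        have "lex_less x m" if "x \<in> supp h" for x
        proof -
          have "x \<noteq> m" using that gm by (auto simp: h_def in_keys_iff lookup_minus cf_const_mult)
          moreover have "x \<in> supp f \<or> x \<in> supp g"
            using that by (auto simp: h_def in_keys_iff lookup_minus cf_const_mult)
          ultimately show ?thesis
            using lead_mon(2)[OF f(2)] lead_mon(2)[OF g(2)] m g(3) by (auto simp: lex.below_def)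
        qed
        then have "lex_less (lead_mon h) m" using lead_mon(1)[OF False] by blast
        moreover have "supp (lead_mon h) \<subseteq> vars_upto n" "supp m \<subseteq> vars_upto n"
          using lead_mon(1)[OF False] bideal_carrier[OF N hN] lead_mon(1)[OF f(2)] bideal_carrier[OF N f(1)] m
          by (auto simp: carrier_iff bmons_def)
        ultimately show ?thesis using 1[of "lead_mon h" h] hN False by auto
      qed (simp add: bideal_0[OF I])
      then have "h + mterm 0 (cf f m / cf g m) * g \<in> I" using cg by (rule bideal_add[OF I])
      then show "f \<in> I" by (simp add: h_def)
    qed
  qed
  then show ?thesis using \<open>I \<subseteq> N\<close> bideal_0[OF I] by blast
qed

text \<open>Turns annihilators of cosets into colon ideals of ring elements, the form in which
  monomials can be computed with.\<close>

lemma (in cring) Ass_iff: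
  assumes I: "ideal I R"
  shows "P \<in> Ass R I \<longleftrightarrow> primeideal P R \<and> (\<exists>c \<in> carrier R. P = {a \<in> carrier R. a \<otimes> c \<in> I})"
proof -
  interpret I: ideal I R by fact
  have zero: "(I +> a) \<otimes>\<^bsub>R Quot I\<^esub> (I +> c) = \<zero>\<^bsub>R Quot I\<^esub> \<longleftrightarrow> a \<otimes> c \<in> I"
    if "a \<in> carrier R" "c \<in> carrier R" for a c
  proof -
    have "(I +> a) \<otimes>\<^bsub>R Quot I\<^esub> (I +> c) = I +> a \<otimes> c"
      using I.rcoset_mult_add[OF that] by (simp add: FactRing_def)
    moreover have "\<zero>\<^bsub>R Quot I\<^esub> = I" by (simp add: FactRing_def)
    ultimately show ?thesis
      using I.rcos_const_imp_mem[OF m_closed[OF that]] I.a_rcos_const[of "a \<otimes> c"] by metis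
  qed
  have carr: "carrier (R Quot I) = (\<lambda>c. I +> c) ` carrier R"
    by (auto simp: FactRing_def A_RCOSETS_def')
  have "P = {a \<in> carrier R. (I +> a) \<otimes>\<^bsub>R Quot I\<^esub> (I +> c) = \<zero>\<^bsub>R Quot I\<^esub>} \<longleftrightarrow>
      P = {a \<in> carrier R. a \<otimes> c \<in> I}" if "c \<in> carrier R" for c
    using zero that by auto
  then show ?thesis unfolding Ass_def carr by auto
qed

section \<open>Orders of vanishing along coordinate subspaces\<close>

definition vdeg :: "bvar set \<Rightarrow> bmon \<Rightarrow> nat" where
  "vdeg V m = (\<Sum>v\<in>V. cf m v)"

lemma vdeg_add [simp]: "vdeg V (a + b) = vdeg V a + vdeg V b"
  by (simp add: vdeg_def lookup_add sum.distrib)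

lemma vdeg_0 [simp]: "vdeg V 0 = 0"
  by (simp add: vdeg_def)

lemma vdeg_eq_0_iff: "finite V \<Longrightarrow> vdeg V m = 0 \<longleftrightarrow> supp m \<inter> V = {}"
  by (auto simp: vdeg_def in_keys_iff)

text \<open>For finite \<open>V\<close>, the filtration by (V)-adic order, taken in all variables
  and not just those up to \<open>n\<close>.\<close>

definition VP :: "bvar set \<Rightarrow> nat \<Rightarrow> 'k::field bpoly set" where
  "VP V k = {p. \<forall>m\<in>supp p. k \<le> vdeg V m}"

lemma VP_0 [simp]: "0 \<in> VP V k"
  by (simp add: VP_def)

lemma VP_add: "p \<in> VP V k \<Longrightarrow> q \<in> VP V k \<Longrightarrow> p + q \<in> VP V k"
  using Poly_Mapping.keys_add[of p q] by (auto simp: VP_def)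

lemma VP_mult: "p \<in> VP V j \<Longrightarrow> q \<in> VP V k \<Longrightarrow> p * q \<in> VP V (j + k)"
  using keys_mult[of p q] by (fastforce simp: VP_def)

lemma VP_mult_left: "q \<in> VP V k \<Longrightarrow> p * q \<in> VP V k"
  using VP_mult[of p V 0 q k] by (simp add: VP_def)

text \<open>Smaller degree in \<open>V\<close> counts as larger, so the degree in \<open>V\<close>
  of the top monomial of a polynomial is its (V)-adic order, and \<open>top_mult\<close> makes this
  order additive. The lexicographic part only breaks ties.\<close>

interpretation vlex: monomial_order
  "\<lambda>a b. vdeg V b < vdeg V a \<or> (vdeg V a = vdeg V b \<and> lex_less a b)" for V
proof
  fix V and a b c :: bmon
  let ?lt = "\<lambda>a b. vdeg V b < vdeg V a \<or> (vdeg V a = vdeg V b \<and> lex_less a b)"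
  show "\<not> ?lt a a" using lex_less_irrefl by simp
  show "?lt a c" if "?lt a b" "?lt b c" using that lex_less_trans[of a b c] by auto
  show "?lt a b \<or> ?lt b a" if "a \<noteq> b" using lex_less_total[OF that] by auto
  show "?lt (a + c) (b + c)" if "?lt a b" using that lex.add_mono[of a b c] by auto
qed

lemma VP_cancel:
  assumes w: "w \<notin> VP V 1" and wp: "w * p \<in> VP V k"
  shows "p \<in> VP V k"
proof (cases "p = 0")
  case False
  have "w \<noteq> 0" using w by auto
  then obtain a where a: "a \<in> supp w" "vlex.below V w a" using vlex.ex_top[of w V] by blast
  obtain b where b: "b \<in> supp p" "vlex.below V p b" using vlex.ex_top[OF False, of V] by blast
  obtain m where "m \<in> supp w" "vdeg V m = 0" using w by (auto simp: VP_def)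
  then have "vdeg V a = 0" using a(2) by (auto simp: vlex.below_def)
  moreover have "a + b \<in> supp (w * p)"
    using vlex.top_mult(2)[OF a(2) b(2)] a(1) b(1) by (simp add: in_keys_iff)
  ultimately have "k \<le> vdeg V b" using wp by (auto simp: VP_def)
  then show ?thesis using b(2) by (auto simp: VP_def vlex.below_def)
qed simp

lemma primeideal_preimage_VP:
  fixes h :: "'k::field bpoly \<Rightarrow> 'k bpoly"
  assumes add: "\<And>p q. h (p + q) = h p + h q" and mult: "\<And>p q. h (p * q) = h p * h q" and one: "h 1 = 1"
  shows "primeideal {p \<in> carrier (bpoly_ring n). h p \<in> VP V 1} (bpoly_ring n)" (is "primeideal ?P _")
proof (rule primeidealI)
  have 0: "h 0 = 0" using add[of 0 0] by simp
  show "ideal ?P (bpoly_ring n)"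
  proof (rule bideal_I)
    show "p + q \<in> ?P" if "p \<in> ?P" "q \<in> ?P" for p q
      using that by (simp add: add carrier_add VP_add)
    show "a * p \<in> ?P" if "a \<in> carrier (bpoly_ring n)" "p \<in> ?P" for a p
      using that by (simp add: mult carrier_mult VP_mult_left)
  qed (auto simp: 0 carrier_iff)
  show "cring (bpoly_ring n :: 'k bpoly ring)" by (rule cring_bpoly_ring)
  have "1 \<in> carrier (bpoly_ring n :: 'k bpoly ring) - ?P"
    by (auto simp: one VP_def carrier_iff)
  then show "carrier (bpoly_ring n) \<noteq> ?P" by blast
  fix a b :: "'k bpoly"
  assume "a \<in> carrier (bpoly_ring n)" "b \<in> carrier (bpoly_ring n)" "a \<otimes>\<^bsub>bpoly_ring n\<^esub> b \<in> ?P"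
  then have "a \<in> carrier (bpoly_ring n)" "b \<in> carrier (bpoly_ring n)" "h a * h b \<in> VP V 1"
    by (simp_all add: mult)
  then show "a \<in> ?P \<or> b \<in> ?P"
    using VP_cancel[of "h a" V "h b" 1] by blast
qed

section \<open>Connectivity and the candidates for leading monomials\<close>

fun vert :: "bvar \<Rightarrow> nat" where
  "vert (X_var i) = i"
| "vert (Y_var i) = i"

lemma X_in_vars_upto [simp]: "X_var i \<in> vars_upto n \<longleftrightarrow> i \<in> {1..n}"
  and Y_in_vars_upto [simp]: "Y_var i \<in> vars_upto n \<longleftrightarrow> i \<in> {1..n}"
  by (auto simp: vars_upto_def)

lemma in_vert_image: "i \<in> vert ` U \<longleftrightarrow> X_var i \<in> U \<or> Y_var i \<in> U"
proof -
  have "vert v = i \<longleftrightarrow> v = X_var i \<or> v = Y_var i" for v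
    by (cases v) auto
  then show ?thesis by (metis image_iff)
qed

definition var :: "bvar \<Rightarrow> 'k::field bpoly" where
  "var v = mterm (mterm v 1) 1"

definition minor :: "nat \<Rightarrow> nat \<Rightarrow> 'k::field bpoly" where
  "minor i j = var (X_var i) * var (Y_var j) - var (X_var j) * var (Y_var i)"

lemma carrier_var: "v \<in> vars_upto n \<Longrightarrow> var v \<in> carrier (bpoly_ring n)"
  unfolding var_def by (rule carrier_mterm) simp

lemma minor_refl [simp]: "minor i i = 0"
  by (simp add: minor_def)

lemma minor_commute: "minor j i = - minor i j"
  by (simp add: minor_def mult.commute)

lemma minor_eq: "minor i j = mterm (mterm (X_var i) 1 + mterm (Y_var j) 1) 1 - mterm (mterm (X_var j) 1 + mterm (Y_var i) 1) 1"
  by (simp add: minor_def var_def mult_single)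

lemma monomial_induct [case_names zero var add]:
  fixes m :: "'a \<Rightarrow>\<^sub>0 nat"
  assumes "P 0" "\<And>v. P (mterm v 1)" "\<And>a b. P a \<Longrightarrow> P b \<Longrightarrow> P (a + b)"
  shows "P m"
proof (induction m rule: poly_induct)
  case (single v c)
  show ?case
  proof (induction c)
    case (Suc c)
    then show ?case using assms(3)[OF assms(2)[of v] Suc] by (simp flip: single_add)
  qed (simp add: assms(1))
qed (use assms in auto)

locale edge_graph =
  fixes n :: nat and E :: "(nat \<times> nat) set"
  assumes E_subset: "E \<subseteq> {1..n} \<times> {1..n}"
    and E_sym: "(i, j) \<in> E \<Longrightarrow> (j, i) \<in> E"
begin

definition J :: "'k::field bpoly set" where
  "J = Idl\<^bsub>bpoly_ring n\<^esub> {minor i j | i j. i < j \<and> (i, j) \<in> E}"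

definition conn :: "nat set \<Rightarrow> nat \<Rightarrow> nat \<Rightarrow> bool" where
  "conn U = (\<lambda>a b. (a, b) \<in> E \<and> a \<in> U \<and> b \<in> U)\<^sup>*\<^sup>*"

text \<open>Every vertex of the connecting path has to carry one of its two variables, no matter
  which. The condition depends on a monomial only through its support, so the resulting ideal is
  squarefree.\<close>

definition nonface :: "bvar set \<Rightarrow> bool" where
  "nonface U \<longleftrightarrow> (\<exists>i j. i < j \<and> X_var i \<in> U \<and> Y_var j \<in> U \<and> conn (vert ` U) i j)"

lemma conn_refl [simp]: "conn U a a"
  by (simp add: conn_def)

lemma conn_trans: "conn U a b \<Longrightarrow> conn U b c \<Longrightarrow> conn U a c"
  unfolding conn_def by (rule rtranclp_trans)

lemma conn_sym: "conn U a b \<Longrightarrow> conn U b a"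
  unfolding conn_def
  by (rule sympD[OF sympI[THEN symp_rtranclp]]) (auto intro: E_sym)

lemma conn_mono: "conn U a b \<Longrightarrow> U \<subseteq> U' \<Longrightarrow> conn U' a b"
  unfolding conn_def by (erule rtranclp_mono[THEN predicate2D, rotated]) auto

lemma conn_in: "conn U a b \<Longrightarrow> a \<in> U \<Longrightarrow> b \<in> U"
  unfolding conn_def by (induction rule: rtranclp_induct) auto

lemma nonface_mono: "nonface U \<Longrightarrow> U \<subseteq> U' \<Longrightarrow> nonface U'"
  unfolding nonface_def using conn_mono[OF _ image_mono] by blast

lemma gens_subset: "{minor i j | i j. i < j \<and> (i, j) \<in> E} \<subseteq> carrier (bpoly_ring n)"
  using E_subset by (auto simp: minor_def intro!: carrier_diff carrier_mult carrier_var)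

lemma ideal_J: "ideal J (bpoly_ring n)"
  unfolding J_def by (rule ring.genideal_ideal[OF cring.axioms(1)[OF cring_bpoly_ring] gens_subset])

lemma edge_minor_in_J: "(i, j) \<in> E \<Longrightarrow> (minor i j :: 'k::field bpoly) \<in> J"
proof -
  assume ij: "(i, j) \<in> E"
  have gen: "minor i j \<in> (J :: 'k bpoly set)" if "i < j" "(i, j) \<in> E" for i j
    unfolding J_def using that
    by (intro subsetD[OF ring.genideal_self[OF cring.axioms(1)[OF cring_bpoly_ring] gens_subset]]) auto
  consider "i < j" | "i = j" | "j < i" by linarith
  then show ?thesis
  proof cases
    case 3
    then have "0 - minor j i \<in> (J :: 'k bpoly set)"
      using gen[OF 3 E_sym[OF ij]] bideal_0[OF ideal_J] by (intro bideal_diff[OF ideal_J]) auto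
    then show ?thesis by (simp add: minor_commute[of i j])
  qed (use gen ij in \<open>auto simp: bideal_0[OF ideal_J]\<close>)
qed

text \<open>Think of the exponent of \<open>x\<^sub>i\<close> as a number of tokens at the vertex \<open>i\<close>, whose capacity is the
  total degree in \<open>x\<^sub>i\<close> and \<open>y\<^sub>i\<close>. An edge binomial moves one token along an edge, and tokens can be
  pushed along a path all of whose vertices have positive capacity.\<close>

lemma path_minor_in_J:
  assumes "conn U i j" "U \<subseteq> {1..n}" "i \<in> U" "j \<in> U" "u \<in> bmons n"
    "U \<subseteq> vert ` supp (u + mterm (X_var i) 1 + mterm (Y_var j) 1)"
  shows "(mterm u 1 * minor i j :: 'k::field bpoly) \<in> J"
  using assms(1) assms(3,5,6) unfolding conn_def
proof (induction arbitrary: u rule: converse_rtranclp_induct)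
  case base
  then show ?case using bideal_0[OF ideal_J] by simp
next
  case (step i v u)
  then have iv: "(i, v) \<in> E" "i \<in> U" "v \<in> U" by auto
  have in_J: "mterm u 1 * p \<in> J" if "u \<in> bmons n" "p \<in> (J :: 'k bpoly set)" for u p
    using that by (intro bideal_mult[OF ideal_J] carrier_mterm)
  note edge = in_J[OF _ edge_minor_in_J[OF iv(1)]]
  have vars: "X_var a \<in> vars_upto n" "Y_var a \<in> vars_upto n" if "a \<in> U" for a
    using that assms(2) by auto
  have "v \<in> vert ` supp (u + mterm (X_var i) 1 + mterm (Y_var j) 1)"
    using step.prems(3) iv(3) by blast
  then consider "v = i" | "v = j" | "X_var v \<in> supp u" | "Y_var v \<in> supp u"
    unfolding in_vert_image by (auto simp: supp_add_nat)
  then show ?case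
  proof cases
    case 1
    then show ?thesis using step by blast
  next
    case 2
    then show ?thesis using edge step.prems by simp
  next
    case 3
    \<comment> \<open>With [a b] for \<open>minor a b\<close>, x_v [i j] = x_i [v j] + x_j [i v]: a
      factor x_v of the multiplier pays for the detour through \<open>v\<close>. The first bracket
      falls under the induction hypothesis, the second belongs to an edge.\<close>
    define w where "w = u - mterm (X_var v) 1"
    have u: "u = w + mterm (X_var v) 1"
      using 3 by (intro poly_mapping_eqI) (auto simp: w_def lookup_add lookup_minus lookup_single when_def in_keys_iff)
    have "mterm (w + mterm (X_var i) 1) 1 * minor v j \<in> (J :: 'k bpoly set)"
      using step.prems iv vars by (intro step.IH) (simp_all add: u ac_simps)
    moreover have "mterm (w + mterm (X_var j) 1) 1 * minor i v \<in> (J :: 'k bpoly set)"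
      using step.prems(2) vars[OF assms(4)] by (intro edge) (simp add: u)
    ultimately have "mterm (w + mterm (X_var i) 1) 1 * minor v j + mterm (w + mterm (X_var j) 1) 1 * minor i v \<in> (J :: 'k bpoly set)"
      by (rule bideal_add[OF ideal_J])
    also have "mterm (w + mterm (X_var i) 1) 1 * minor v j + mterm (w + mterm (X_var j) 1) 1 * minor i v =
        mterm u 1 * (minor i j :: 'k bpoly)"
      by (simp add: minor_eq u mult_single right_diff_distrib ac_simps)
    finally show ?thesis .
  next
    case 4
    \<comment> \<open>Likewise y_v [i j] = y_i [v j] + y_j [i v]. In the monomial of the covering
      condition x_i y_v becomes y_i x_v, but the vertices it touches stay the same.\<close>
    define w where "w = u - mterm (Y_var v) 1"
    have u: "u = w + mterm (Y_var v) 1"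
      using 4 by (intro poly_mapping_eqI) (auto simp: w_def lookup_add lookup_minus lookup_single when_def in_keys_iff)
    have "mterm (w + mterm (Y_var i) 1) 1 * minor v j \<in> (J :: 'k bpoly set)"
    proof (rule step.IH)
      have "vert ` supp (w + mterm (Y_var i) 1 + mterm (X_var v) 1 + mterm (Y_var j) 1) =
          vert ` supp (u + mterm (X_var i) 1 + mterm (Y_var j) 1)"
        by (auto simp: u supp_add_nat image_Un)
      then show "U \<subseteq> vert ` supp (w + mterm (Y_var i) 1 + mterm (X_var v) 1 + mterm (Y_var j) 1)"
        using step.prems(3) by simp
    qed (use step.prems iv vars in \<open>simp_all add: u\<close>)
    moreover have "mterm (w + mterm (Y_var j) 1) 1 * minor i v \<in> (J :: 'k bpoly set)"
      using step.prems(2) vars[OF assms(4)] by (intro edge) (simp add: u)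
    ultimately have "mterm (w + mterm (Y_var i) 1) 1 * minor v j + mterm (w + mterm (Y_var j) 1) 1 * minor i v \<in> (J :: 'k bpoly set)"
      by (rule bideal_add[OF ideal_J])
    also have "mterm (w + mterm (Y_var i) 1) 1 * minor v j + mterm (w + mterm (Y_var j) 1) 1 * minor i v =
        mterm u 1 * (minor i j :: 'k bpoly)"
      by (simp add: minor_eq u mult_single right_diff_distrib ac_simps)
    finally show ?thesis .
  qed
qed

end

section \<open>Facets and the associated substitutions\<close>

definition mdeg :: "bmon \<Rightarrow> nat \<Rightarrow> nat" where
  "mdeg m i = cf m (X_var i) + cf m (Y_var i)"

lemma mdeg_add: "mdeg (a + b) i = mdeg a i + mdeg b i"
  by (simp add: mdeg_def lookup_add)

locale facet = edge_graph +
  fixes F :: "bvar set"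
  assumes F_subset: "F \<subseteq> vars_upto n"
    and face: "\<not> nonface F"
    and maximal: "v \<in> vars_upto n \<Longrightarrow> v \<notin> F \<Longrightarrow> nonface (insert v F)"
begin

abbreviation V :: "bvar set" where "V \<equiv> vars_upto n - F"

abbreviation W :: "nat set" where "W \<equiv> vert ` F"

text \<open>On each component of the graph induced on \<open>W\<close>, the facet switches from
  y-variables to x-variables at this vertex.\<close>

definition thr :: "nat \<Rightarrow> nat" where
  "thr i = Max {j. Y_var j \<in> F \<and> conn W i j}"

lemma finite_F: "finite F"
  using F_subset by (rule finite_subset) simp

lemma W_subset: "W \<subseteq> {1..n}"
  using F_subset by (auto simp: vars_upto_def)

lemma face_conn: "X_var p \<in> F \<Longrightarrow> Y_var q \<in> F \<Longrightarrow> conn W p q \<Longrightarrow> q \<le> p"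
  using face unfolding nonface_def by (meson not_le)

text \<open>Let \<open>l\<close> be the smallest vertex of the component. Adding
  \<open>Y_var l\<close> could complete a non-face only with some x_p, p < l, of the same component,
  and there is no such vertex. By maximality \<open>Y_var l\<close> is already in
  \<open>F\<close>.\<close>

lemma ex_Y: assumes "i \<in> W" shows "\<exists>j. Y_var j \<in> F \<and> conn W i j"
proof (rule ccontr)
  assume no: "\<not> ?thesis"
  define l where "l = Min {j. conn W i j}"
  have "{j. conn W i j} \<subseteq> W" using conn_in[OF _ assms] by auto
  then have fin: "finite {j. conn W i j}" using finite_F by (rule finite_subset[OF _ finite_imageI])
  have "l \<in> {j. conn W i j}" unfolding l_def by (rule Min_in[OF fin]) (use conn_refl in blast)
  then have l: "conn W i l" by simp
  then have lW: "l \<in> W" "Y_var l \<notin> F" using conn_in[OF l assms] no by auto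
  moreover have "Y_var l \<in> vars_upto n" using lW(1) W_subset by auto
  ultimately have "nonface (insert (Y_var l) F)" using maximal by blast
  then obtain p q where pq: "p < q" "X_var p \<in> F" "Y_var q \<in> insert (Y_var l) F" "conn W p q"
    using insert_absorb[OF lW(1)] unfolding nonface_def by auto
  have "q = l"
  proof (rule ccontr)
    assume "q \<noteq> l"
    then have "q \<le> p" using pq by (intro face_conn) auto
    then show False using pq(1) by simp
  qed
  then have "conn W i p" using conn_trans[OF l] conn_sym[OF pq(4)] by simp
  then have "l \<le> p" unfolding l_def using fin by auto
  then show False using pq(1) \<open>q = l\<close> by simp
qed

text \<open>For \<open>X_thr\<close>: adding the x-variable of the threshold could complete a
  non-face only with some y_q of \<open>F\<close> beyond the threshold in the same component,
  against the choice of the maximum.\<close>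

lemma thr:
  assumes "i \<in> W"
  shows Y_thr: "Y_var (thr i) \<in> F" and conn_thr: "conn W i (thr i)" and X_thr: "X_var (thr i) \<in> F"
    and le_thr: "\<And>j. Y_var j \<in> F \<Longrightarrow> conn W i j \<Longrightarrow> j \<le> thr i"
proof -
  let ?A = "{j. Y_var j \<in> F \<and> conn W i j}"
  have "?A \<subseteq> W" using conn_in[OF _ assms] by auto
  then have fin: "finite ?A" using finite_F by (rule finite_subset[OF _ finite_imageI])
  have "thr i \<in> ?A" unfolding thr_def by (rule Max_in[OF fin]) (use ex_Y[OF assms] in blast)
  then show Y: "Y_var (thr i) \<in> F" and c: "conn W i (thr i)" by auto
  show le: "j \<le> thr i" if "Y_var j \<in> F" "conn W i j" for j
    unfolding thr_def using fin that by auto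
  show "X_var (thr i) \<in> F"
  proof (rule ccontr)
    assume no: "X_var (thr i) \<notin> F"
    have tW: "thr i \<in> W" by (rule conn_in[OF c assms])
    then have "X_var (thr i) \<in> vars_upto n" using W_subset by auto
    then have "nonface (insert (X_var (thr i)) F)" using maximal no by blast
    then obtain p q where pq: "p < q" "X_var p \<in> insert (X_var (thr i)) F" "Y_var q \<in> F" "conn W p q"
      using insert_absorb[OF tW] unfolding nonface_def by auto
    have "p = thr i"
    proof (rule ccontr)
      assume "p \<noteq> thr i"
      then have "q \<le> p" using pq by (intro face_conn) auto
      then show False using pq(1) by simp
    qed
    then have "q \<le> thr i" using le[OF pq(3)] conn_trans[OF c] pq(4) by simp
    then show False using pq(1) \<open>p = thr i\<close> by simp
  qed
qed

lemma thr_cong: "conn W i j \<Longrightarrow> thr i = thr j"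
  unfolding thr_def by (metis conn_sym conn_trans)

lemma thr_in_W: "i \<in> W \<Longrightarrow> thr i \<in> W"
  by (rule conn_in[OF conn_thr])

lemma thr_thr: "i \<in> W \<Longrightarrow> thr (thr i) = thr i"
  using conn_thr thr_cong by metis

text \<open>A vertex of \<open>W\<close> carries at least one of its variables. If it carries x_i,
  the face condition against the y-variable of the threshold bounds \<open>i\<close> from below; if
  it carries y_i, the maximum bounds \<open>i\<close> from above. The threshold itself carries
  both.\<close>

lemma X_in_F_iff: assumes "i \<in> W" shows "X_var i \<in> F \<longleftrightarrow> thr i \<le> i"
  and Y_in_F_iff: "Y_var i \<in> F \<longleftrightarrow> i \<le> thr i"
proof -
  have XY: "X_var i \<in> F \<or> Y_var i \<in> F"
    using assms by (simp add: in_vert_image)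
  have X: "thr i \<le> i" if "X_var i \<in> F"
    using that face_conn Y_thr[OF assms] conn_thr[OF assms] by blast
  have Y: "i \<le> thr i" if "Y_var i \<in> F"
    using le_thr[OF assms that] by simp
  show "X_var i \<in> F \<longleftrightarrow> thr i \<le> i"
    using X Y XY X_thr[OF assms] by (metis antisym)
  show "Y_var i \<in> F \<longleftrightarrow> i \<le> thr i"
    using X Y XY Y_thr[OF assms] by (metis antisym)
qed

text \<open>On a component of the graph induced on \<open>W\<close> the generic point of the minimal prime lies on
  \<open>(x\<^sub>i, y\<^sub>i) = c\<^sub>i (x\<^sub>l, y\<^sub>l)\<close>, where \<open>l\<close> is the threshold. The substitution \<open>x\<^sub>i \<mapsto> x\<^sub>i + x\<^sub>l y\<^sub>i / y\<^sub>l\<close>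
  (\<open>i < l\<close>), \<open>y\<^sub>j \<mapsto> y\<^sub>j + y\<^sub>l x\<^sub>j / x\<^sub>l\<close> (\<open>j > l\<close>) straightens it to the coordinate subspace \<open>V = 0\<close>; scaling
  both variables of a vertex by \<open>scale\<close> removes the denominators and does not affect \<open>J\<close>.\<close>

definition scale :: "nat \<Rightarrow> bmon" where
  "scale i = (if i \<notin> W then 0 else if i < thr i then mterm (Y_var (thr i)) 1
     else if thr i < i then mterm (X_var (thr i)) 1 else 0)"

fun \<sigma> :: "bvar \<Rightarrow> 'k::field bpoly" where
  "\<sigma> (X_var i) = mterm (mterm (X_var i) 1 + scale i) 1 +
     (if i \<in> W \<and> i < thr i then mterm (mterm (X_var (thr i)) 1 + mterm (Y_var i) 1) 1 else 0)"
| "\<sigma> (Y_var i) = mterm (mterm (Y_var i) 1 + scale i) 1 +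
     (if i \<in> W \<and> thr i < i then mterm (mterm (Y_var (thr i)) 1 + mterm (X_var i) 1) 1 else 0)"

abbreviation \<phi> :: "'k::field bpoly \<Rightarrow> 'k bpoly" where "\<phi> \<equiv> subst \<sigma>"

lemma \<phi>_var: "\<phi> (var v) = \<sigma> v"
  unfolding var_def subst_single subst_mono_var by simp

lemma \<phi>_1: "\<phi> 1 = 1"
  using subst_single[of \<sigma> 0 1] by simp

lemma finite_V: "finite V"
  by simp

lemma mterm_in_VP: "v \<in> V \<Longrightarrow> mterm (mterm v (Suc 0) + a) c \<in> VP V 1"
  using vdeg_eq_0_iff[OF finite_V, of "mterm v (Suc 0) + a"] by (auto simp: VP_def supp_add_nat)

lemma \<sigma>_outside:
  assumes "i \<in> {1..n}" "i \<notin> W" shows "\<sigma> (X_var i) \<in> VP V 1" "\<sigma> (Y_var i) \<in> VP V 1"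
proof -
  have "X_var i \<notin> F" "Y_var i \<notin> F" using assms(2) by force+
  then show "\<sigma> (X_var i) \<in> VP V 1" "\<sigma> (Y_var i) \<in> VP V 1"
    using assms mterm_in_VP[of "X_var i" 0 1] mterm_in_VP[of "Y_var i" 0 1] by (simp_all add: scale_def)
qed

text \<open>Modulo (V) the pair (x_i, y_i) goes to a multiple of (x_l, y_l), where l is the
  threshold; the factor \<alpha> is y_i before l, 1 at l and x_i after l. Pairs from one component
  become parallel, which puts their minor into (V).\<close>

lemma \<sigma>_inside:
  assumes "i \<in> W"
  obtains \<alpha> a b :: "'k::field bpoly" where "a \<in> VP V 1" "b \<in> VP V 1"
    "\<sigma> (X_var i) = var (X_var (thr i)) * \<alpha> + a" "\<sigma> (Y_var i) = var (Y_var (thr i)) * \<alpha> + b"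
proof -
  note iff = X_in_F_iff[OF assms] Y_in_F_iff[OF assms]
  have i: "i \<in> {1..n}" using assms W_subset by blast
  consider "i < thr i" | "i = thr i" | "thr i < i" by linarith
  then show ?thesis
  proof cases
    case 1
    then have "X_var i \<in> V" using iff i by auto
    from mterm_in_VP[OF this, of "scale i" 1] show ?thesis
      using 1 assms
      by (intro that[of "mterm (mterm (X_var i) (Suc 0) + scale i) 1" 0 "var (Y_var i)"])
         (simp_all add: scale_def var_def mult_single ac_simps)
  next
    case 2
    then show ?thesis by (intro that[of 0 0 1]) (simp_all add: scale_def var_def)
  next
    case 3
    then have "Y_var i \<in> V" using iff i by auto
    from mterm_in_VP[OF this, of "scale i" 1] show ?thesis
      using 3 assms
      by (intro that[of 0 "mterm (mterm (Y_var i) (Suc 0) + scale i) 1" "var (X_var i)"])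
         (simp_all add: scale_def var_def mult_single ac_simps)
  qed
qed

lemma \<phi>_minor:
  assumes "(i, j) \<in> E" shows "\<phi> (minor i j) \<in> VP V 1"
proof -
  have ij: "i \<in> {1..n}" "j \<in> {1..n}" using assms E_subset by auto
  have eq: "\<phi> (minor i j) = \<sigma> (X_var i) * \<sigma> (Y_var j) - \<sigma> (X_var j) * \<sigma> (Y_var i)"
    by (simp add: minor_def subst_diff subst_mult \<phi>_var del: \<sigma>.simps)
  have diff: "p - q \<in> VP V 1" if "p \<in> VP V 1" "q \<in> VP V 1" for p q :: "'k::field bpoly"
    using VP_add[OF that(1), of "- q"] that(2) by (simp add: VP_def)
  consider "i \<notin> W" | "j \<notin> W" | "i \<in> W" "j \<in> W" by blast
  then show ?thesis
  proof cases
    case 1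
    note s = \<sigma>_outside[OF ij(1) 1]
    have "\<sigma> (Y_var j) * \<sigma> (X_var i) - \<sigma> (X_var j) * \<sigma> (Y_var i) \<in> VP V 1"
      by (intro diff VP_mult_left s)
    then show ?thesis unfolding eq by (simp only: mult.commute)
  next
    case 2
    note s = \<sigma>_outside[OF ij(2) 2]
    have "\<sigma> (X_var i) * \<sigma> (Y_var j) - \<sigma> (Y_var i) * \<sigma> (X_var j) \<in> VP V 1"
      by (intro diff VP_mult_left s)
    then show ?thesis unfolding eq by (simp only: mult.commute)
  next
    case 3
    have "conn W i j" unfolding conn_def using 3 assms by blast
    then have l: "thr j = thr i" using thr_cong by simp
    obtain \<alpha> a b :: "'a bpoly" where i: "a \<in> VP V 1" "b \<in> VP V 1"
      "\<sigma> (X_var i) = var (X_var (thr i)) * \<alpha> + a" "\<sigma> (Y_var i) = var (Y_var (thr i)) * \<alpha> + b"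
      by (rule \<sigma>_inside[OF 3(1)])
    obtain \<beta> c d :: "'a bpoly" where j: "c \<in> VP V 1" "d \<in> VP V 1"
      "\<sigma> (X_var j) = var (X_var (thr i)) * \<beta> + c" "\<sigma> (Y_var j) = var (Y_var (thr i)) * \<beta> + d"
      by (rule \<sigma>_inside[OF 3(2), unfolded l])
    let ?x = "var (X_var (thr i)) :: 'a bpoly" and ?y = "var (Y_var (thr i)) :: 'a bpoly"
    \<comment> \<open>The products of two parallel parts cancel, and each remaining summand contains
      one of \<open>a\<close>, \<open>b\<close>, \<open>c\<close>, \<open>d\<close>.\<close>
    have "\<phi> (minor i j) = (?x * \<alpha>) * d + (?y * \<beta> + d) * a - ((?x * \<beta>) * b + (?y * \<alpha> + b) * c)"
      unfolding eq i(3,4) j(3,4) by (simp add: algebra_simps)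
    then show ?thesis by (simp only:) (intro diff VP_add VP_mult_left i(1,2) j(1,2))
  qed
qed

lemma primeideal_P: "primeideal {p \<in> carrier (bpoly_ring n). \<phi> p \<in> VP V 1} (bpoly_ring n)"
  by (rule primeideal_preimage_VP) (rule subst_add subst_mult \<phi>_1)+

lemma J_subset_P: "J \<subseteq> {p \<in> carrier (bpoly_ring n). \<phi> p \<in> VP V 1}"
  unfolding J_def
  by (rule ring.genideal_minimal[OF cring.axioms(1)[OF cring_bpoly_ring] primeideal.axioms(1)[OF primeideal_P]])
     (use gens_subset \<phi>_minor in blast)

lemma \<phi>_J_power: "p \<in> ideal_power (bpoly_ring n) J k \<Longrightarrow> \<phi> p \<in> VP V k"
proof (induction k arbitrary: p)
  case 0
  show ?case by (simp add: VP_def)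
next
  case (Suc k)
  from Suc.prems have "p \<in> ideal_prod (bpoly_ring n) (ideal_power (bpoly_ring n) J k) J" by simp
  then show ?case
  proof induction
    case (prod a b)
    then show ?case using VP_mult[OF Suc.IH, of a "\<phi> b" 1] J_subset_P by (auto simp: subst_mult)
  next
    case (sum a b)
    then show ?case by (simp add: subst_add VP_add)
  qed
qed

text \<open>Exponent of the product of all scaling factors picked up by \<open>m\<close>; it depends
  on \<open>m\<close> only through its multidegree.\<close>

definition scales :: "bmon \<Rightarrow> bmon" where
  "scales m = (\<Sum>i\<in>W. \<Sum>k<mdeg m i. scale i)"

lemma scales_add: "scales (a + b) = scales a + scales b"
proof -
  have "(\<Sum>k<s + t. scale i) = (\<Sum>k<s. scale i) + (\<Sum>k<t. scale i)" for i and s t :: nat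
    by (induction t) (simp_all add: ac_simps)
  then show ?thesis by (simp add: scales_def mdeg_add sum.distrib)
qed

lemma scales_var: "scales (mterm v 1) = scale (vert v)"
proof -
  have eq: "(\<Sum>k<mdeg (mterm v 1) i. scale i) = (if i = vert v then scale i else 0)" for i
    by (cases v) (auto simp: mdeg_def lookup_single when_def)
  show ?thesis
    unfolding scales_def eq using finite_F by (simp add: sum.delta scale_def)
qed

lemma scales_0 [simp]: "scales 0 = 0"
  using scales_add[of 0 0] by simp

lemma vdeg_scales: "vdeg V (scales m) = 0"
proof (induction m rule: monomial_induct)
  case (var v)
  have "supp (scale i) \<subseteq> F" for i
    using X_thr Y_thr by (auto simp: scale_def)
  then show ?case unfolding scales_var vdeg_eq_0_iff[OF finite_V] by blast
qed (simp_all add: scales_add)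

lemma mdeg_scales_eq_0:
  assumes "scale i \<noteq> 0" shows "mdeg (scales m) i = 0"
proof (induction m rule: monomial_induct)
  case (var v)
  have "i \<noteq> thr j" if "j \<in> W" for j
    using assms thr_thr[OF that] by (auto simp: scale_def split: if_splits)
  then show ?case unfolding scales_var by (auto simp: mdeg_def scale_def lookup_single when_def)
qed (simp_all add: scales_add mdeg_def lookup_add)

text \<open>Scaling factors are threshold variables, while thresholds are never scaled. At a scaled
  vertex \<open>a + scales a\<close> therefore has the same degree as \<open>a\<close>, and these
  degrees alone determine \<open>scales a\<close>.\<close>

lemma scales_eq:
  assumes "\<And>i. mdeg (a + scales a) i = mdeg (b + scales b) i"
  shows "scales a = scales b"
proof -
  have "(\<Sum>k<mdeg a i. scale i) = (\<Sum>k<mdeg b i. scale i)" for i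
  proof (cases "scale i = 0")
    case False
    then show ?thesis using assms[of i] by (simp add: mdeg_add mdeg_scales_eq_0)
  qed simp
  then show ?thesis by (simp add: scales_def)
qed

text \<open>All three claims are multiplicative in \<open>a\<close>, so single variables suffice.
  The image of a variable has at most two terms, of equal multidegree, and the scaled variable is
  the larger one.\<close>

lemma subst_mono_top:
  "lex.below (subst_mono \<sigma> a :: 'k::field bpoly) (a + scales a) \<and>
   cf (subst_mono \<sigma> a :: 'k bpoly) (a + scales a) = 1 \<and>
   (\<forall>m\<in>supp (subst_mono \<sigma> a :: 'k bpoly). \<forall>i. mdeg m i = mdeg (a + scales a) i)"
proof (induction a rule: monomial_induct)
  case zero
  show ?case by (simp add: lex.below_def)
next
  case (var v)
  let ?s = "mterm v 1 + scale (vert v)"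
  have "\<exists>b. \<sigma> v = mterm ?s (1::'k) + b \<and> (b = 0 \<or> (\<exists>t. b = mterm t 1 \<and> lex_less t ?s \<and> (\<forall>i. mdeg t i = mdeg ?s i)))"
  proof (cases v)
    case (X_var i)
    show ?thesis
    proof (cases "i \<in> W \<and> i < thr i")
      case True
      have "lex_less (mterm (X_var (thr i)) 1 + mterm (Y_var i) 1) ?s"
        unfolding lex_less_def using True X_var
        by (intro exI[of _ "X_var i"]) (auto simp: lookup_add lookup_single when_def scale_def elim!: var_gt.elims)
      then show ?thesis using True X_var
        by (intro exI[of _ "mterm (mterm (X_var (thr i)) 1 + mterm (Y_var i) 1) 1"])
           (auto simp: scale_def mdeg_def lookup_add lookup_single when_def)
    qed (use X_var in auto)
  next
    case (Y_var i)
    show ?thesis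
    proof (cases "i \<in> W \<and> thr i < i")
      case True
      \<comment> \<open>Here the scaling factor decides: with l = \<open>thr i\<close> below
        \<open>i\<close>, the variable x_l makes y_i x_l larger than y_l x_i.\<close>
      have "lex_less (mterm (Y_var (thr i)) 1 + mterm (X_var i) 1) ?s"
        unfolding lex_less_def using True Y_var
        by (intro exI[of _ "X_var (thr i)"]) (auto simp: lookup_add lookup_single when_def scale_def elim!: var_gt.elims)
      then show ?thesis using True Y_var
        by (intro exI[of _ "mterm (mterm (Y_var (thr i)) 1 + mterm (X_var i) 1) 1"])
           (auto simp: scale_def mdeg_def lookup_add lookup_single when_def)
    qed (use Y_var in auto)
  qed
  then obtain b where b: "\<sigma> v = mterm ?s (1::'k) + b"
    "b = 0 \<or> (\<exists>t. b = mterm t 1 \<and> lex_less t ?s \<and> (\<forall>i. mdeg t i = mdeg ?s i))" by blast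
  have key: "t = ?s \<or> t \<in> supp b" if "t \<in> supp (\<sigma> v :: 'k bpoly)" for t
    using that Poly_Mapping.keys_add[of "mterm ?s (1::'k)" b] unfolding b(1) by (auto split: if_splits)
  have low: "lex_less t ?s \<and> (\<forall>i. mdeg t i = mdeg ?s i)" if "t \<in> supp b" for t
    using that b(2) by (auto split: if_splits)
  have "cf b ?s = 0"
    using b(2) lex_less_irrefl by (auto simp: lookup_single when_def)
  then have "cf (\<sigma> v :: 'k bpoly) ?s = 1"
    unfolding b(1) lookup_add lookup_single_eq by simp
  then show ?case
    unfolding subst_mono_var scales_var lex.below_def using key low by blast
next
  case (add a b)
  note IH = add[THEN conjunct1] add[THEN conjunct2, THEN conjunct1] add[THEN conjunct2, THEN conjunct2]
  note top = lex.top_mult[OF IH(1,2), folded subst_mono_add]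
  have one: "cf (subst_mono \<sigma> (a + b) :: 'k bpoly) (a + scales a + (b + scales b)) = 1"
    unfolding top(2) IH(3,4) by simp
  have "mdeg m i = mdeg (a + scales a + (b + scales b)) i" if m: "m \<in> supp (subst_mono \<sigma> (a + b) :: 'k bpoly)" for m i
  proof -
    obtain c d where "m = c + d" "c \<in> supp (subst_mono \<sigma> a :: 'k bpoly)" "d \<in> supp (subst_mono \<sigma> b :: 'k bpoly)"
      using m keys_mult unfolding subst_mono_add by blast
    then show ?thesis using IH(5,6) by (simp add: mdeg_add)
  qed
  moreover have "a + b + scales (a + b) = a + scales a + (b + scales b)"
    by (simp add: scales_add ac_simps)
  ultimately show ?case using top(1) one by simp
qed

text \<open>The substitution does not respect the lexicographic order, but within one multidegree it changes
  leading monomials by a common factor, and distinct multidegrees do not interfere.\<close>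

lemma vdeg_lead_mon:
  fixes f :: "'k::field bpoly"
  assumes f: "f \<noteq> 0" "\<phi> f \<in> VP V k"
  shows "k \<le> vdeg V (lead_mon f)"
proof -
  define m where "m = lead_mon f"
  have m: "m \<in> supp f" "lex.below f m" using lead_mon[OF f(1)] by (auto simp: m_def)
  \<comment> \<open>Nothing can cancel at \<open>m + scales m\<close>: a monomial \<open>a\<close>
    contributing there has the same shift by \<open>scales_eq\<close>, so \<open>m\<close> would be
    at most \<open>a\<close>, whereas \<open>m\<close> is the largest monomial of
    \<open>f\<close>.\<close>
  have "cf (subst_mono \<sigma> a) (m + scales m) = (0::'k)" if a: "a \<in> supp f" "a \<noteq> m" for a
  proof (rule ccontr)
    assume "cf (subst_mono \<sigma> a) (m + scales m) \<noteq> (0::'k)"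
    then have key: "m + scales m \<in> supp (subst_mono \<sigma> a :: 'k bpoly)" by (simp add: in_keys_iff)
    then have "scales m = scales a" using subst_mono_top[of a, where 'k = 'k] by (intro scales_eq) auto
    then have "m + scales a = a + scales a \<or> lex_less (m + scales a) (a + scales a)"
      using key subst_mono_top[of a, where 'k = 'k] unfolding lex.below_def by metis
    then have "m = a \<or> lex_less m a" by (auto simp: lex_less_def lookup_add)
    then show False using m(2) a lex_less_irrefl lex_less_trans unfolding lex.below_def by metis
  qed
  then have "cf (\<phi> f) (m + scales m) = (\<Sum>a\<in>supp f. if a = m then cf f a else 0)"
    unfolding subst_def lookup_sum cf_const_mult
    using subst_mono_top[of m, where 'k = 'k] by (intro sum.cong) auto
  then have "m + scales m \<in> supp (\<phi> f)"
    using m(1) by (simp add: in_keys_iff)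
  then show ?thesis using f(2) vdeg_scales[of m] by (auto simp: VP_def m_def)
qed

end

section \<open>Minimality of the primes attached to facets\<close>

definition sqfree :: "bvar set \<Rightarrow> bmon" where
  "sqfree A = (\<Sum>v\<in>A. mterm v 1)"

lemma cf_sqfree: "finite A \<Longrightarrow> cf (sqfree A) v = (if v \<in> A then 1 else 0)"
  by (simp add: sqfree_def lookup_sum lookup_single when_def sum.delta)

lemma supp_sqfree [simp]: "finite A \<Longrightarrow> supp (sqfree A) = A"
  by (auto simp: in_keys_iff cf_sqfree split: if_splits)

context facet
begin

definition vf :: "'k::field bpoly set" where
  "vf = {p. \<forall>m\<in>supp p. supp m \<subseteq> F}"

lemma vf_carrier: "p \<in> vf \<Longrightarrow> p \<in> carrier (bpoly_ring n)"
  using F_subset by (auto simp: vf_def carrier_iff bmons_def)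

lemma vf_add: "p \<in> vf \<Longrightarrow> q \<in> vf \<Longrightarrow> p + q \<in> vf"
  using Poly_Mapping.keys_add[of p q] by (auto simp: vf_def)

lemma vf_mult:
  assumes "p \<in> vf" "q \<in> vf" shows "p * q \<in> vf"
  unfolding vf_def
proof (intro CollectI ballI)
  fix m assume "m \<in> supp (p * q)"
  then obtain a b where "m = a + b" "a \<in> supp p" "b \<in> supp q" using keys_mult by blast
  then show "supp m \<subseteq> F" using assms by (simp add: vf_def supp_add_nat)
qed

lemma vf_mterm [simp]: "supp m \<subseteq> F \<Longrightarrow> mterm m c \<in> vf"
  by (simp add: vf_def)

lemma vf_var [simp]: "v \<in> F \<Longrightarrow> var v \<in> vf"
  unfolding var_def by (rule vf_mterm) simp

text \<open>A leading monomial in the variables of \<open>F\<close> has degree 0 in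
  \<open>V\<close>, but an image in (V) would make that degree positive. Nonzero elements of
  \<open>vf\<close> can thus serve as denominators.\<close>

lemma vf_notin_VP:
  assumes "p \<in> vf" "p \<noteq> 0" shows "\<phi> p \<notin> VP V 1"
proof
  assume "\<phi> p \<in> VP V 1"
  then have "vdeg V (lead_mon p) \<noteq> 0" using vdeg_lead_mon[OF assms(2)] by fastforce
  then show False
    using lead_mon(1)[OF assms(2)] assms(1) unfolding vdeg_eq_0_iff[OF finite_V] by (auto simp: vf_def)
qed

definition P :: "'k::field bpoly set" where
  "P = {p \<in> carrier (bpoly_ring n). \<phi> p \<in> VP V 1}"

text \<open>The contraction of the localization of \<open>J\<close> at \<open>P\<close>; the prime \<open>P\<close> is minimal over \<open>J\<close> once \<open>P \<subseteq> Loc\<close>.\<close>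

definition Loc :: "'k::field bpoly set" where
  "Loc = {p \<in> carrier (bpoly_ring n). \<exists>h \<in> carrier (bpoly_ring n). \<phi> h \<notin> VP V 1 \<and> h * p \<in> J}"

lemma ideal_Loc: "ideal Loc (bpoly_ring n)"
proof (rule bideal_I)
  show "Loc \<subseteq> carrier (bpoly_ring n)" by (auto simp: Loc_def)
  show "0 \<in> Loc"
    using bideal_0[OF ideal_J] by (auto simp: Loc_def carrier_iff \<phi>_1 VP_def intro!: bexI[of _ 1])
next
  fix p q :: "'a bpoly" assume p: "p \<in> Loc" and q: "q \<in> Loc"
  obtain h where h: "h \<in> carrier (bpoly_ring n)" "\<phi> h \<notin> VP V 1" "h * p \<in> J" using p by (auto simp: Loc_def)
  obtain g where g: "g \<in> carrier (bpoly_ring n)" "\<phi> g \<notin> VP V 1" "g * q \<in> J" using q by (auto simp: Loc_def)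
  have "g * (h * p) + h * (g * q) \<in> J"
    by (rule bideal_add[OF ideal_J bideal_mult[OF ideal_J g(1) h(3)] bideal_mult[OF ideal_J h(1) g(3)]])
  then have "(h * g) * (p + q) \<in> J" by (simp add: algebra_simps)
  moreover have "\<phi> (h * g) \<notin> VP V 1"
    using VP_cancel[OF h(2), of "\<phi> g" 1] g(2) by (auto simp: subst_mult)
  ultimately show "p + q \<in> Loc"
    using p q carrier_mult[OF h(1) g(1)] by (auto simp: Loc_def carrier_add)
next
  fix a p :: "'a bpoly" assume a: "a \<in> carrier (bpoly_ring n)" and p: "p \<in> Loc"
  obtain h where h: "h \<in> carrier (bpoly_ring n)" "\<phi> h \<notin> VP V 1" "h * p \<in> J" using p by (auto simp: Loc_def)
  have "h * (a * p) \<in> J" using bideal_mult[OF ideal_J a h(3)] by (simp add: ac_simps)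
  then show "a * p \<in> Loc" using h p a by (auto simp: Loc_def carrier_mult)
qed

lemma Loc_I: "p \<in> carrier (bpoly_ring n) \<Longrightarrow> h \<in> vf \<Longrightarrow> h \<noteq> 0 \<Longrightarrow> h * p \<in> J \<Longrightarrow> p \<in> Loc"
  unfolding Loc_def using vf_carrier vf_notin_VP by blast

lemma carrier_minor: "i \<in> {1..n} \<Longrightarrow> j \<in> {1..n} \<Longrightarrow> minor i j \<in> carrier (bpoly_ring n)"
  unfolding minor_def by (intro carrier_diff carrier_mult carrier_var) simp_all

text \<open>As a multiplier it touches every vertex of \<open>W\<close>, so
  \<open>path_minor_in_J\<close> applies to all paths inside \<open>W\<close>; being a monomial in
  the variables of \<open>F\<close>, it is an admissible denominator.\<close>

definition S :: "'k::field bpoly" where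
  "S = mterm (sqfree F) 1"

lemma S_vf: "S \<in> vf" and S_neq_0: "S \<noteq> 0"
  by (simp_all add: S_def finite_F)

lemma S_minor_in_J:
  assumes "i \<in> {1..n}" "conn (insert i W) i j"
  shows "S * minor i j \<in> J"
  unfolding S_def
proof (rule path_minor_in_J[OF assms(2)])
  show "insert i W \<subseteq> vert ` supp (sqfree F + mterm (X_var i) 1 + mterm (Y_var j) 1)"
    by (auto simp: supp_add_nat finite_F image_Un)
  show "j \<in> insert i W" using conn_in[OF assms(2)] by simp
qed (use assms W_subset F_subset finite_F in \<open>auto simp: bmons_def\<close>)

lemma minor_in_Loc: assumes "i \<in> W" shows "minor i (thr i) \<in> Loc"
proof (rule Loc_I[OF _ S_vf S_neq_0])
  show "minor i (thr i) \<in> carrier (bpoly_ring n)"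
    using assms thr_in_W[OF assms] W_subset by (intro carrier_minor) blast+
  show "S * minor i (thr i) \<in> J"
    using assms conn_thr[OF assms] W_subset by (intro S_minor_in_J) (auto simp: insert_absorb)
qed

text \<open>By maximality of the facet, adding a vertex outside \<open>W\<close> must join two components.\<close>

lemma joins_components:
  assumes i: "i \<in> {1..n}" "i \<notin> W"
  obtains a b where "a \<in> W" "b \<in> W" "conn (insert i W) i a" "conn (insert i W) i b" "\<not> conn W a b"
proof (rule ccontr)
  note obt = that
  assume no: "\<not> thesis"
  then have one: "conn W a b" if "a \<in> W" "b \<in> W" "conn (insert i W) i a" "conn (insert i W) i b" for a b
    using obt[OF that] no by blast
  have split: "conn W a b \<or> conn (insert i W) a i" if "conn (insert i W) a b" "a \<in> W" for a b
    using that(1)[unfolded conn_def]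
  proof (induction rule: rtranclp_induct)
    case (step b c)
    then have abc: "conn (insert i W) a b" "(b, c) \<in> E" "b \<in> insert i W" "c \<in> insert i W"
      unfolding conn_def by blast+
    then have bc: "conn (insert i W) b c" unfolding conn_def by blast
    show ?case
    proof (cases "b = i \<or> c = i")
      case True
      then show ?thesis using abc(1) conn_trans[OF abc(1) bc] by auto
    next
      case False
      then have "conn W b c" using abc unfolding conn_def by blast
      then show ?thesis using step.IH conn_trans[of W a b c] by blast
    qed
  qed simp
  have XY: "X_var i \<notin> F" "Y_var i \<notin> F" using i(2) by (auto simp: in_vert_image)
  have inW: "p \<in> W" if "X_var p \<in> F \<or> Y_var p \<in> F" for p
    using that by (simp add: in_vert_image)
  \<comment> \<open>Adding \<open>i\<close> creates no new violation inside \<open>F\<close>: a path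
    through \<open>i\<close> joins vertices which, by the assumption being refuted, already lie in
    one component of \<open>W\<close>.\<close>
  have both: "q \<le> p" if "X_var p \<in> F" "Y_var q \<in> F" "conn (insert i W) p q" for p q
  proof -
    have "conn W p q"
    proof (cases "conn W p q")
      case False
      then have "conn (insert i W) p i" using split[OF that(3)] inW that by blast
      then have "conn (insert i W) i p" by (rule conn_sym)
      then show ?thesis using one[of p q] inW that conn_trans[of "insert i W" i p q] by blast
    qed
    then show ?thesis using face_conn that by blast
  qed
  \<comment> \<open>By \<open>both\<close> the new variable takes part in each non-face: x_i pairs
    with some y_q, i < q, and y_i with some x_p', p' < i. Both vertices are reached through
    \<open>i\<close>, so p' < q violates \<open>both\<close>.\<close>
  have "nonface (insert (X_var i) F)" "nonface (insert (Y_var i) F)"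
    using maximal XY i by auto
  then obtain p q p' q' where
    pq: "p < q" "X_var p \<in> insert (X_var i) F" "Y_var q \<in> F" "conn (insert i W) p q" and
    pq': "p' < q'" "X_var p' \<in> F" "Y_var q' \<in> insert (Y_var i) F" "conn (insert i W) p' q'"
    unfolding nonface_def by auto
  have "p = i" using pq both[of p q] by fastforce
  moreover have "q' = i" using pq' both[of p' q'] by fastforce
  ultimately have "conn (insert i W) p' q" using pq(4) pq'(4) conn_trans[of "insert i W" p' i q] by simp
  then have "q \<le> p'" using both pq(3) pq'(2) by blast
  then show False using pq(1) pq'(1) \<open>p = i\<close> \<open>q' = i\<close> by simp
qed

text \<open>Cramer's rule: modulo denominators the pair at \<open>i\<close> is parallel to the pairs
  at the thresholds l and l' of two different components, whose minor is invertible, so it vanishes.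
  Explicitly, [l' l] x_i = x_l' [i l] - x_l [i l'], and the same with y in place of x outside the
  brackets.\<close>

lemma outside_in_Loc:
  assumes i: "i \<in> {1..n}" "i \<notin> W"
  shows "(var (X_var i) :: 'k::field bpoly) \<in> Loc" "(var (Y_var i) :: 'k bpoly) \<in> Loc"
proof -
  obtain a b where ab: "a \<in> W" "b \<in> W" "conn (insert i W) i a" "conn (insert i W) i b" "\<not> conn W a b"
    using joins_components[OF i] by blast
  define l where "l = thr a"
  define l' where "l' = thr b"
  have W: "l \<in> W" "l' \<in> W" using ab thr_in_W by (auto simp: l_def l'_def)
  then have ln: "l \<in> {1..n}" "l' \<in> {1..n}" using W_subset by auto
  have F: "X_var l \<in> F" "Y_var l \<in> F" "X_var l' \<in> F" "Y_var l' \<in> F"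
    using ab X_thr Y_thr by (auto simp: l_def l'_def)
  have c: "conn W a l" "conn W b l'" using conn_thr ab by (auto simp: l_def l'_def)
  then have ne: "l \<noteq> l'" using ab(5) conn_sym conn_trans by metis
  have "conn (insert i W) i l" "conn (insert i W) i l'"
    using c ab(3,4) conn_trans conn_mono[OF _ subset_insertI] by blast+
  then have mem: "(S * minor i l :: 'k bpoly) \<in> J" "(S * minor i l' :: 'k bpoly) \<in> J"
    using S_minor_in_J[OF i(1)] by auto
  let ?h = "S * minor l' l :: 'k bpoly"
  have vf_minor: "(minor l' l :: 'k bpoly) \<in> vf"
    using F by (simp add: minor_eq) (auto simp: vf_def supp_add_nat dest!: subsetD[OF Poly_Mapping.keys_diff] split: if_splits)
  have "mterm (X_var l') 1 + mterm (Y_var l) 1 \<noteq> mterm (X_var l) 1 + mterm (Y_var l') (1::nat)"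
    using ne by (auto simp: poly_mapping_eq_iff fun_eq_iff lookup_add lookup_single when_def intro!: exI[of _ "X_var l"])
  then have "cf (minor l' l :: 'k bpoly) (mterm (X_var l') 1 + mterm (Y_var l) 1) = 1"
    unfolding minor_eq lookup_minus by (simp add: lookup_single)
  then have "(minor l' l :: 'k bpoly) \<noteq> 0" by auto
  then have h: "?h \<in> vf" "?h \<noteq> 0"
    using vf_mult[OF S_vf vf_minor] lead_mon_mult(1)[OF S_neq_0, of "minor l' l"] by auto
  have "?h * var (X_var i) = var (X_var l') * (S * minor i l) - var (X_var l) * (S * minor i l')"
    by (simp add: minor_def algebra_simps)
  also have "\<dots> \<in> J"
    using ln by (intro bideal_diff[OF ideal_J] bideal_mult[OF ideal_J _ mem(1)] bideal_mult[OF ideal_J _ mem(2)] carrier_var) simp_all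
  finally show "(var (X_var i) :: 'k bpoly) \<in> Loc"
    using h i by (intro Loc_I[of _ ?h] carrier_var) simp_all
  have "?h * var (Y_var i) = var (Y_var l') * (S * minor i l) - var (Y_var l) * (S * minor i l')"
    by (simp add: minor_def algebra_simps)
  also have "\<dots> \<in> J"
    using ln by (intro bideal_diff[OF ideal_J] bideal_mult[OF ideal_J _ mem(1)] bideal_mult[OF ideal_J _ mem(2)] carrier_var) simp_all
  finally show "(var (Y_var i) :: 'k bpoly) \<in> Loc"
    using h i by (intro Loc_I[of _ ?h] carrier_var) simp_all
qed

text \<open>Up to a multiplier outside \<open>P\<close>, reducible polynomials agree modulo \<open>Loc\<close> with polynomials in the
  variables of \<open>F\<close>, on which \<open>P\<close> has no nonzero elements.\<close>

definition reducible :: "'k::field bpoly \<Rightarrow> bool" where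
  "reducible p \<longleftrightarrow> (\<exists>u q. u \<in> vf \<and> u \<noteq> 0 \<and> q \<in> vf \<and> u * p - q \<in> Loc)"

lemma reducible_add:
  assumes "reducible p" "reducible p'" shows "reducible (p + p')"
proof -
  obtain u q where u: "u \<in> vf" "u \<noteq> 0" "q \<in> vf" "u * p - q \<in> Loc" using assms(1) by (auto simp: reducible_def)
  obtain u' q' where u': "u' \<in> vf" "u' \<noteq> 0" "q' \<in> vf" "u' * p' - q' \<in> Loc" using assms(2) by (auto simp: reducible_def)
  have "u' * (u * p - q) + u * (u' * p' - q') \<in> Loc"
    by (rule bideal_add[OF ideal_Loc bideal_mult[OF ideal_Loc vf_carrier[OF u'(1)] u(4)]
          bideal_mult[OF ideal_Loc vf_carrier[OF u(1)] u'(4)]])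
  moreover have "u' * (u * p - q) + u * (u' * p' - q') = (u * u') * (p + p') - (u' * q + u * q')"
    by (simp add: algebra_simps)
  ultimately show ?thesis unfolding reducible_def
    using u u' vf_mult vf_add lead_mon_mult(1)[OF u(2) u'(2)] by metis
qed

lemma reducible_mult:
  assumes "reducible p" "reducible p'" "p' \<in> carrier (bpoly_ring n)" shows "reducible (p * p')"
proof -
  obtain u q where u: "u \<in> vf" "u \<noteq> 0" "q \<in> vf" "u * p - q \<in> Loc" using assms(1) by (auto simp: reducible_def)
  obtain u' q' where u': "u' \<in> vf" "u' \<noteq> 0" "q' \<in> vf" "u' * p' - q' \<in> Loc" using assms(2) by (auto simp: reducible_def)
  have "(u' * p') * (u * p - q) + q * (u' * p' - q') \<in> Loc"
    by (rule bideal_add[OF ideal_Loc bideal_mult[OF ideal_Loc carrier_mult[OF vf_carrier[OF u'(1)] assms(3)] u(4)]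
          bideal_mult[OF ideal_Loc vf_carrier[OF u(3)] u'(4)]])
  moreover have "(u' * p') * (u * p - q) + q * (u' * p' - q') = (u * u') * (p * p') - q * q'"
    by (simp add: algebra_simps)
  ultimately show ?thesis unfolding reducible_def
    using u u' vf_mult lead_mon_mult(1)[OF u(2) u'(2)] by metis
qed

lemma reducible_vf: "p \<in> vf \<Longrightarrow> reducible p"
  unfolding reducible_def using bideal_0[OF ideal_Loc]
  by (intro exI[of _ 1] exI[of _ p]) (auto simp: vf_def)

text \<open>At a vertex of \<open>W\<close> the minor with the threshold trades the missing variable
  for the other one, with a threshold variable as denominator. Outside \<open>W\<close> the variable
  vanishes modulo \<open>Loc\<close>.\<close>

lemma reducible_var: assumes "v \<in> vars_upto n" shows "reducible (var v :: 'k::field bpoly)"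
proof (cases "v \<in> F")
  case True
  then show ?thesis by (intro reducible_vf) simp
next
  case False
  have vn: "vert v \<in> {1..n}" using assms by (cases v) auto
  show ?thesis
  proof (cases "vert v \<in> W")
    case W: True
    let ?l = "thr (vert v)"
    show ?thesis
    proof (cases v)
      case (X_var i)
      then have "Y_var i \<in> F" using W False by (auto simp: in_vert_image)
      then have "var (X_var ?l) * var (Y_var i) \<in> (vf :: 'k bpoly set)" "(var (Y_var ?l) :: 'k bpoly) \<in> vf"
        using X_thr[OF W] Y_thr[OF W] by (auto intro: vf_mult)
      moreover have "var (Y_var ?l) * var v - var (X_var ?l) * var (Y_var i) \<in> (Loc :: 'k bpoly set)"
        using minor_in_Loc[OF W, where 'a = 'k] X_var by (simp add: minor_def mult.commute)
      moreover have "(var (Y_var ?l) :: 'k bpoly) \<noteq> 0" by (simp add: var_def)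
      ultimately show ?thesis unfolding reducible_def by blast
    next
      case (Y_var i)
      then have "X_var i \<in> F" using W False by (auto simp: in_vert_image)
      then have "var (Y_var ?l) * var (X_var i) \<in> (vf :: 'k bpoly set)" "(var (X_var ?l) :: 'k bpoly) \<in> vf"
        using X_thr[OF W] Y_thr[OF W] by (auto intro: vf_mult)
      moreover have "var (X_var ?l) * var v - var (Y_var ?l) * var (X_var i) \<in> (Loc :: 'k bpoly set)"
        using bideal_diff[OF ideal_Loc bideal_0[OF ideal_Loc] minor_in_Loc[OF W, where 'a = 'k]] Y_var
        by (simp add: minor_def mult.commute)
      moreover have "(var (X_var ?l) :: 'k bpoly) \<noteq> 0" by (simp add: var_def)
      ultimately show ?thesis unfolding reducible_def by blast
    qed
  next
    case W: False
    have "(var v :: 'k bpoly) \<in> Loc" using outside_in_Loc[OF vn W] by (cases v) auto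
    then show ?thesis unfolding reducible_def
      by (intro exI[of _ 1] exI[of _ 0]) (auto simp: vf_def)
  qed
qed

lemma reducible:
  assumes "p \<in> carrier (bpoly_ring n)" shows "reducible (p :: 'k::field bpoly)"
proof -
  have mon: "m \<in> bmons n \<longrightarrow> reducible (mterm m (1::'k))" for m
  proof (induction m rule: monomial_induct)
    case zero
    show ?case by (intro impI reducible_vf) (simp add: vf_def)
  next
    case (var v)
    show ?case using reducible_var[of v, where 'k = 'k] by (simp add: var_def)
  next
    case (add a b)
    then show ?case
      using reducible_mult[of "mterm a 1" "mterm b (1::'k)"] carrier_mterm[of b n 1] by (auto simp: mult_single)
  qed
  have "reducible (\<Sum>m\<in>A. mterm m (cf p m))" if "finite A" "A \<subseteq> supp p" for A
    using that
  proof (induction A rule: finite_induct)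
    case empty
    show ?case by (intro reducible_vf) (simp add: vf_def)
  next
    case (insert m A)
    then have "m \<in> bmons n" using assms by (auto simp: carrier_iff)
    then have "reducible (mterm 0 (cf p m) * mterm m 1)"
      using mon carrier_mterm by (intro reducible_mult[OF reducible_vf]) auto
    then show ?case using insert by (simp add: mult_single reducible_add)
  qed
  from this[of "supp p"] show ?thesis using sum_mterm[of p] by simp
qed

text \<open>If \<open>u * p\<close> agrees with \<open>q\<close> modulo \<open>Loc\<close>, then
  \<open>q\<close> is an element of \<open>P\<close> in the variables of \<open>F\<close>, hence 0.
  The factor \<open>u\<close> is then absorbed into the denominator.\<close>

lemma P_subset_Loc: "P \<subseteq> Loc"
proof
  fix p :: "'a bpoly" assume p: "p \<in> P"
  then have pc: "p \<in> carrier (bpoly_ring n)" by (simp add: P_def)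
  obtain u q where u: "u \<in> vf" "u \<noteq> 0" "q \<in> vf" "u * p - q \<in> Loc"
    using reducible[OF pc] by (auto simp: reducible_def)
  obtain h where h: "h \<in> carrier (bpoly_ring n)" "\<phi> h \<notin> VP V 1" "h * (u * p - q) \<in> J"
    using u(4) by (auto simp: Loc_def)
  have "\<phi> h * \<phi> (u * p - q) \<in> VP V 1" using h(3) J_subset_P by (auto simp flip: subst_mult)
  then have "\<phi> (u * p - q) \<in> VP V 1" by (rule VP_cancel[OF h(2)])
  moreover have "\<phi> (u * p) \<in> VP V 1" using p by (simp add: P_def subst_mult VP_mult_left)
  ultimately have "\<phi> (u * p) + (- 1) * \<phi> (u * p - q) \<in> VP V 1" by (intro VP_add VP_mult_left)
  then have "\<phi> q \<in> VP V 1" by (simp add: subst_diff)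
  then have "q = 0" using vf_notin_VP[OF u(3)] by blast
  then have "(h * u) * p \<in> J" using h(3) by (simp add: mult.assoc)
  moreover have "\<phi> (h * u) \<notin> VP V 1"
    using VP_cancel[OF h(2)] vf_notin_VP[OF u(1,2)] by (auto simp: subst_mult)
  ultimately show "p \<in> Loc" unfolding Loc_def using pc carrier_mult[OF h(1) vf_carrier[OF u(1)]] by blast
qed

lemma P_in_min_primes: "P \<in> min_primes (bpoly_ring n) J"
  unfolding min_primes_def
proof (intro CollectI conjI allI impI)
  show "primeideal P (bpoly_ring n)" unfolding P_def by (rule primeideal_P)
  show "J \<subseteq> P" unfolding P_def by (rule J_subset_P)
  fix Q :: "'a bpoly set" assume Q: "primeideal Q (bpoly_ring n)" "J \<subseteq> Q" "Q \<subseteq> P"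
  have "P \<subseteq> Q"
  proof
    fix p :: "'a bpoly" assume p: "p \<in> P"
    then obtain h where h: "p \<in> carrier (bpoly_ring n)" "h \<in> carrier (bpoly_ring n)" "\<phi> h \<notin> VP V 1" "h * p \<in> J"
      using P_subset_Loc by (auto simp: Loc_def)
    then have "h \<in> Q \<or> p \<in> Q" using primeideal.I_prime[OF Q(1) h(2,1)] Q(2) by auto
    then show "p \<in> Q" using h(3) Q(3) by (auto simp: P_def)
  qed
  then show "Q = P" using Q(3) by blast
qed

lemma symbolic_power_vdeg:
  assumes "f \<in> symbolic_power (bpoly_ring n) J k" "f \<noteq> 0"
  shows "k \<le> vdeg V (lead_mon f)"
proof -
  obtain w where w: "w \<in> carrier (bpoly_ring n)" "w \<notin> P" "w * f \<in> ideal_power (bpoly_ring n) J k"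
    using assms(1) P_in_min_primes by (auto simp: symbolic_power_def)
  then have "\<phi> w \<notin> VP V 1" by (simp add: P_def)
  moreover have "\<phi> w * \<phi> f \<in> VP V k" using \<phi>_J_power[OF w(3)] by (simp add: subst_mult)
  ultimately show ?thesis using VP_cancel vdeg_lead_mon[OF assms(2)] by blast
qed

end

section \<open>The initial ideal and the associated primes of its powers\<close>

context edge_graph
begin

lemma ex_facet:
  assumes "U \<subseteq> vars_upto n" "\<not> nonface U"
  obtains F where "facet n E F" "U \<subseteq> F"
proof -
  let ?A = "{F. U \<subseteq> F \<and> F \<subseteq> vars_upto n \<and> \<not> nonface F}"
  have "finite ?A" by (rule finite_subset[of _ "Pow (vars_upto n)"]) auto
  from finite_has_maximal2[OF this, of U] assms obtain F
    where F: "F \<in> ?A" "\<And>F'. F' \<in> ?A \<Longrightarrow> F \<subseteq> F' \<Longrightarrow> F = F'" by auto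
  have "facet n E F"
  proof
    show "nonface (insert v F)" if "v \<in> vars_upto n" "v \<notin> F" for v
      using F(2)[of "insert v F"] F(1) that by blast
  qed (use F(1) in auto)
  then show ?thesis using that F(1) by blast
qed

text \<open>For the second inclusion, dividing \<open>m\<close> by x_i y_j leaves a multiplier
  \<open>u\<close> that makes the path passable, and i < j makes x_i y_j the leading monomial of the
  minor.\<close>

lemma LM_J: "LM (J :: 'k::field bpoly set) = {m \<in> bmons n. nonface (supp m)}"
proof
  show "LM (J :: 'k bpoly set) \<subseteq> {m \<in> bmons n. nonface (supp m)}"
  proof
    fix m assume "m \<in> LM (J :: 'k bpoly set)"
    then obtain f :: "'k bpoly" where f: "f \<in> J" "f \<noteq> 0" "m = lead_mon f" by (auto simp: LM_def)
    have m: "m \<in> bmons n"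
      using lead_mon(1)[OF f(2)] f(3) bideal_carrier[OF ideal_J f(1)] by (auto simp: carrier_iff)
    have "nonface (supp m)"
    proof (rule ccontr)
      assume "\<not> nonface (supp m)"
      then obtain F where "facet n E F" and F: "supp m \<subseteq> F"
        using ex_facet[of "supp m"] m by (auto simp: bmons_def)
      then interpret facet n E F by simp
      have "\<phi> f \<in> VP V 1" using f(1) J_subset_P by blast
      then have "vdeg V m \<noteq> 0" using vdeg_lead_mon[OF f(2)] f(3) by fastforce
      then show False using F by (auto simp: vdeg_eq_0_iff)
    qed
    then show "m \<in> {m \<in> bmons n. nonface (supp m)}" using m by simp
  qed
  show "{m \<in> bmons n. nonface (supp m)} \<subseteq> LM (J :: 'k bpoly set)"
  proof safe
    fix m assume m: "m \<in> bmons n" "nonface (supp m)"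
    then obtain i j where ij: "i < j" "X_var i \<in> supp m" "Y_var j \<in> supp m" "conn (vert ` supp m) i j"
      by (auto simp: nonface_def)
    define u where "u = m - mterm (X_var i) 1 - mterm (Y_var j) 1"
    have mu: "m = u + mterm (X_var i) 1 + mterm (Y_var j) 1"
      using ij(2,3) by (intro poly_mapping_eqI)
        (auto simp: u_def lookup_add lookup_minus lookup_single when_def in_keys_iff)
    have verts: "vert ` supp m \<subseteq> {1..n}"
      using m(1) by (fastforce simp: bmons_def vars_upto_def)
    have "i \<in> vert ` supp m" "j \<in> vert ` supp m"
      using ij(2,3) by (auto simp: in_vert_image)
    then have mem: "(mterm u 1 * minor i j :: 'k bpoly) \<in> J"
      using m(1) by (intro path_minor_in_J[OF ij(4) verts]) (simp_all add: mu)
    have "lex_less (mterm (X_var j) 1 + mterm (Y_var i) 1) (mterm (X_var i) 1 + mterm (Y_var j) 1)"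
      unfolding lex_less_def using ij(1)
      by (intro exI[of _ "X_var i"]) (auto simp: lookup_add lookup_single when_def elim!: var_gt.elims)
    then have "lex_less (mterm (X_var j) 1 + mterm (Y_var i) 1 + u) (mterm (X_var i) 1 + mterm (Y_var j) 1 + u)"
      by (rule lex.add_mono)
    then have less: "lex_less (u + (mterm (X_var j) 1 + mterm (Y_var i) 1)) m"
      unfolding mu by (simp only: ac_simps)
    have eq: "mterm u 1 * minor i j = mterm m (1::'k) - mterm (u + (mterm (X_var j) 1 + mterm (Y_var i) 1)) 1"
      by (simp add: minor_eq right_diff_distrib mult_single mu add.assoc)
    have "cf (mterm u 1 * minor i j) m = (1::'k)"
      unfolding eq using less lex_less_irrefl[of m] by (auto simp: lookup_minus lookup_single when_def)
    then have "m \<in> supp (mterm u 1 * minor i j :: 'k bpoly)" by (simp add: in_keys_iff)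
    moreover have "lex.below (mterm u 1 * minor i j :: 'k bpoly) m"
      unfolding eq lex.below_def
      using less by (auto dest!: subsetD[OF Poly_Mapping.keys_diff] split: if_splits)
    ultimately have "lead_mon (mterm u 1 * minor i j :: 'k bpoly) = m" "(mterm u 1 * minor i j :: 'k bpoly) \<noteq> 0"
      by (auto intro: lead_monI)
    then show "m \<in> LM (J :: 'k bpoly set)" unfolding LM_def using mem by (metis DiffI image_eqI singletonD)
  qed
qed

definition M :: "bmon set" where
  "M = {m \<in> bmons n. nonface (supp m)}"

lemma upset_M: "upset n M"
  unfolding upset_def M_def by (auto simp: supp_add_nat intro: nonface_mono)

lemma M_supp: "a \<in> M \<Longrightarrow> b \<in> bmons n \<Longrightarrow> supp a \<subseteq> supp b \<Longrightarrow> b \<in> M"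
  by (auto simp: M_def intro: nonface_mono)

text \<open>Since \<open>M\<close> is generated by squarefree monomials, exponents beyond \<open>k\<close> are irrelevant.\<close>

lemma mpow_M_truncate:
  assumes "m \<in> mpow n M k" "m' \<in> bmons n" "\<And>v. min k (cf m v) \<le> cf m' v"
  shows "m' \<in> mpow n M k"
proof -
  have "\<exists>q \<in> mpow n M k. \<forall>v. cf q v \<le> min k (cf m v)"
    using assms(1)
  proof (induction k arbitrary: m)
    case 0
    then show ?case by (auto intro!: bexI[of _ 0])
  next
    case (Suc k)
    then obtain a b where ab: "m = a + b" "a \<in> mpow n M k" "b \<in> M" by auto
    obtain q where q: "q \<in> mpow n M k" "\<And>v. cf q v \<le> min k (cf a v)" using Suc.IH[OF ab(2)] by blast
    \<comment> \<open>Each factor from \<open>M\<close> is replaced by its radical, so it adds at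
      most one to any exponent.\<close>
    have "sqfree (supp b) \<in> M"
      using ab(3) by (rule M_supp) (use ab(3) in \<open>auto simp: M_def bmons_def\<close>)
    then have "q + sqfree (supp b) \<in> mpow n M (Suc k)" using q(1) by auto
    moreover have "cf (q + sqfree (supp b)) v \<le> min (Suc k) (cf m v)" for v
      using q(2)[of v] by (auto simp: ab(1) lookup_add cf_sqfree in_keys_iff)
    ultimately show ?case by blast
  qed
  then obtain q where q: "q \<in> mpow n M k" "\<And>v. cf q v \<le> min k (cf m v)" by blast
  have le: "cf q v \<le> cf m' v" for v using q(2) assms(3) order.trans by blast
  then have "m' = q + (m' - q)"
    by (intro poly_mapping_eqI) (simp add: lookup_add lookup_minus)
  moreover have "m' - q \<in> bmons n"
    using assms(2) by (auto simp: bmons_def in_keys_iff lookup_minus subset_iff)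
  ultimately show ?thesis using upset_add[OF upset_mpow[OF upset_M] q(1)] by metis
qed

text \<open>A multiple \<open>m'\<close> of \<open>m\<close> with maximal exponents, truncated at \<open>k\<close>, has a colon ideal generated by variables.\<close>

lemma ex_colon_variables:
  assumes "m \<in> bmons n" "m \<notin> mpow n M k"
  obtains m' V where "m' \<in> bmons n" "V \<subseteq> vars_upto n" "\<And>v. cf m v \<le> cf m' v"
    "\<And>u. u \<in> bmons n \<Longrightarrow> u + m' \<in> mpow n M k \<longleftrightarrow> supp u \<inter> V \<noteq> {}"
proof -
  let ?Q = "\<lambda>m'. m' \<in> bmons n \<and> m' \<notin> mpow n M k \<and> (\<forall>v. cf m v \<le> cf m' v)"
  \<comment> \<open>Exponents are unbounded, but degrees truncated at \<open>k\<close> are not, so a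
    maximal candidate exists.\<close>
  let ?f = "\<lambda>m'. \<Sum>v\<in>vars_upto n. min k (cf m' v)"
  have "\<exists>x. ?Q x \<and> (\<forall>y. ?Q y \<longrightarrow> ?f y \<le> ?f x)"
  proof (rule ex_has_greatest_nat[where P = ?Q and f = ?f and b = "Suc (card (vars_upto n) * k)"])
    show "?Q m" using assms by simp
    show "\<forall>y. ?Q y \<longrightarrow> ?f y < Suc (card (vars_upto n) * k)"
      using sum_bounded_above[of "vars_upto n" _ k] by (simp add: less_Suc_eq_le)
  qed
  then obtain m' where m': "?Q m'" and max: "\<And>y. ?Q y \<Longrightarrow> ?f y \<le> ?f m'" by blast
  define V where "V = {v \<in> vars_upto n. mterm v 1 + m' \<in> mpow n M k}"
  note up = upset_mpow[OF upset_M, of k]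
  \<comment> \<open>Otherwise multiplication by \<open>v\<close> keeps the candidate outside the
    power, since \<open>v\<close> is not in \<open>V\<close>, and raises its truncated
    degree.\<close>
  have big: "k \<le> cf m' v" if v: "v \<in> vars_upto n" "v \<notin> V" for v
  proof (rule ccontr)
    assume "\<not> ?thesis"
    then have "?f m' < ?f (mterm v 1 + m')"
    proof (intro sum_strict_mono_ex1)
      show "\<exists>a\<in>vars_upto n. min k (cf m' a) < min k (cf (mterm v 1 + m') a)"
        using v(1) \<open>\<not> k \<le> cf m' v\<close> by (intro bexI[of _ v]) (simp_all add: lookup_add)
    qed (auto simp: lookup_add min_def)
    moreover have "?Q (mterm v 1 + m')"
      using m' v by (simp add: V_def lookup_add trans_le_add2)
    ultimately show False using max by (meson not_less)
  qed
  have "u + m' \<in> mpow n M k \<longleftrightarrow> supp u \<inter> V \<noteq> {}" if u: "u \<in> bmons n" for u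
  proof
    assume mem: "u + m' \<in> mpow n M k"
    show "supp u \<inter> V \<noteq> {}"
    proof
      assume disj: "supp u \<inter> V = {}"
      \<comment> \<open>A monomial avoiding \<open>V\<close> raises only exponents that have reached
        \<open>k\<close>, which truncation does not see.\<close>
      have le: "min k (cf (u + m') v) \<le> cf m' v" for v
      proof (cases "v \<in> supp u")
        case True
        then have "v \<in> vars_upto n" "v \<notin> V" using disj u by (auto simp: bmons_def)
        then have "k \<le> cf m' v" by (rule big)
        then show ?thesis by simp
      qed (simp add: lookup_add in_keys_iff)
      have "m' \<in> mpow n M k" by (rule mpow_M_truncate[OF mem _ le]) (use m' in blast)
      then show False using m' by blast
    qed
  next
    assume "supp u \<inter> V \<noteq> {}"
    then obtain v where v: "v \<in> supp u" "mterm v 1 + m' \<in> mpow n M k" by (auto simp: V_def)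
    have "u + m' = (mterm v 1 + m') + (u - mterm v 1)"
      using v(1) by (intro poly_mapping_eqI) (auto simp: lookup_add lookup_minus lookup_single when_def in_keys_iff)
    moreover have "u - mterm v 1 \<in> bmons n"
      using u by (auto simp: bmons_def in_keys_iff lookup_minus subset_iff)
    ultimately show "u + m' \<in> mpow n M k" using upset_add[OF up v(2)] by simp
  qed
  moreover have "V \<subseteq> vars_upto n" by (auto simp: V_def)
  moreover have "m' \<in> bmons n" "\<And>v. cf m v \<le> cf m' v" using m' by blast+
  ultimately show ?thesis by (intro that[of m' V])
qed

text \<open>Some term \<open>t\<close> of an element with annihilator (V) lies outside
  \<open>M\<close>, and multiplying it by any variable of \<open>V\<close> leads into
  \<open>M\<close>; squarefreeness keeps \<open>t\<close> away from \<open>V\<close>. Monomials of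
  \<open>M\<close> all meet \<open>V\<close>, so the complement is a face, and \<open>t\<close>
  shows that no variable can be added. The monomial \<open>t\<close> is exported because it
  witnesses that in(J) and (V) agree after localization at (V).\<close>

lemma facet_if_associated:
  assumes V: "V \<subseteq> vars_upto n"
    and ass: "{p \<in> carrier (bpoly_ring n). p \<in> VP V 1} \<in> Ass (bpoly_ring n) (mono_ideal M :: 'k::field bpoly set)" (is "?P \<in> _")
  obtains t where "t \<in> bmons n" "supp t \<inter> V = {}" "\<And>v. v \<in> V \<Longrightarrow> mterm v 1 + t \<in> M"
    "facet n E (vars_upto n - V)"
proof -
  have fin: "finite V" using V by (rule finite_subset) simp
  obtain c :: "'k bpoly" where prime: "primeideal ?P (bpoly_ring n)" and c: "c \<in> carrier (bpoly_ring n)"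
    "?P = {a \<in> carrier (bpoly_ring n). a * c \<in> mono_ideal M}"
    using ass cring.Ass_iff[OF cring_bpoly_ring ideal_mono_ideal[OF upset_M], of ?P] by auto
  have P_iff: "mterm a 1 \<in> ?P \<longleftrightarrow> supp a \<inter> V \<noteq> {}" if "a \<in> bmons n" for a
    using that vdeg_eq_0_iff[OF fin, of a] carrier_mterm[OF that, of 1] by (auto simp: VP_def Suc_le_eq)
  have "(1 :: 'k bpoly) \<notin> ?P" by (simp add: VP_def)
  then have "c \<notin> mono_ideal M" unfolding c(2) by (simp add: carrier_iff)
  then obtain t where t: "t \<in> supp c" "t \<notin> M" by (auto simp: mono_ideal_def)
  have tb: "t \<in> bmons n" using t c(1) by (auto simp: carrier_iff)
  have vt: "mterm v 1 + t \<in> M" if "v \<in> V" for v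
  proof -
    have "mterm (mterm v 1) 1 \<in> ?P" using that V by (subst P_iff) auto
    then have "c * mterm (mterm v 1) 1 \<in> mono_ideal M" unfolding c(2) by (simp add: mult.commute)
    then show ?thesis using t(1) unfolding mono_ideal_def mem_Collect_eq supp_mult_mterm
      by (auto simp: add.commute)
  qed
  have disj: "supp t \<inter> V = {}"
  proof (rule ccontr)
    assume "supp t \<inter> V \<noteq> {}"
    then obtain v where "v \<in> supp t" "v \<in> V" by blast
    then have "t \<in> M" using M_supp[OF vt tb] by (auto simp: supp_add_nat)
    then show False using t(2) by simp
  qed
  have M_V: "supp a \<inter> V \<noteq> {}" if a: "a \<in> M" for a
  proof -
    have ab: "a \<in> bmons n" using a by (simp add: M_def)
    have "c * mterm a 1 \<in> mono_ideal M"
      using bideal_mult[OF ideal_mono_ideal[OF upset_M] c(1), of "mterm a 1"] a by simp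
    then have "mterm a 1 \<in> ?P" unfolding c(2) using carrier_mterm[OF ab] by (simp add: mult.commute)
    then show ?thesis using P_iff[OF ab] by blast
  qed
  have "facet n E (vars_upto n - V)"
  proof
    show "\<not> nonface (vars_upto n - V)"
      using M_V[of "sqfree (vars_upto n - V)"] by (auto simp: M_def bmons_def)
    show "nonface (insert v (vars_upto n - V))" if "v \<in> vars_upto n" "v \<notin> vars_upto n - V" for v
    proof (rule nonface_mono)
      show "nonface (supp (mterm v 1 + t))" using vt[of v] that by (auto simp: M_def)
      show "supp (mterm v 1 + t) \<subseteq> insert v (vars_upto n - V)"
        using disj tb by (auto simp: supp_add_nat bmons_def)
    qed
  qed auto
  with that tb disj vt show ?thesis by blast
qed

lemma symbolic_power_lead_mon:
  assumes ntf: "normally_torsion_free (bpoly_ring n) (initial_ideal n (J :: 'k::field bpoly set))" and k: "k \<ge> 1"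
    and f: "f \<in> symbolic_power (bpoly_ring n) (J :: 'k bpoly set) k" "f \<noteq> 0"
  shows "lead_mon f \<in> mpow n M k"
proof (rule ccontr)
  define m where "m = lead_mon f"
  assume "lead_mon f \<notin> mpow n M k"
  moreover have mb: "m \<in> bmons n"
    using lead_mon(1)[OF f(2)] f(1) by (auto simp: m_def symbolic_power_def carrier_iff)
  ultimately obtain m' V where m': "m' \<in> bmons n" "V \<subseteq> vars_upto n" "\<And>v. cf m v \<le> cf m' v"
    and colon: "\<And>u. u \<in> bmons n \<Longrightarrow> u + m' \<in> mpow n M k \<longleftrightarrow> supp u \<inter> V \<noteq> {}"
    using ex_colon_variables[of m k] by (auto simp: m_def)
  have fin: "finite V" using m'(2) by (rule finite_subset) simp
  let ?P = "{p \<in> carrier (bpoly_ring n). p \<in> VP V 1} :: 'k bpoly set"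
  have "primeideal ?P (bpoly_ring n)"
    using primeideal_preimage_VP[of "\<lambda>p. p" n V] by simp
  moreover have "1 \<le> vdeg V a \<longleftrightarrow> a + m' \<in> mpow n M k" if "a \<in> bmons n" for a
    unfolding colon[OF that] vdeg_eq_0_iff[OF fin, symmetric] by linarith
  then have "?P = {p \<in> carrier (bpoly_ring n). p * mterm m' 1 \<in> mono_ideal (mpow n M k)}"
    unfolding mono_ideal_def mem_Collect_eq supp_mult_mterm VP_def carrier_iff by blast
  ultimately have "?P \<in> Ass (bpoly_ring n) (mono_ideal (mpow n M k))"
    using cring.Ass_iff[OF cring_bpoly_ring ideal_mono_ideal[OF upset_mpow[OF upset_M]], of ?P] carrier_mterm[OF m'(1), of 1]
    by auto
  moreover have "initial_ideal n (J :: 'k bpoly set) = mono_ideal M"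
    unfolding initial_ideal_eq[OF ideal_J] LM_J M_def ..
  ultimately have "?P \<in> Ass (bpoly_ring n) (mono_ideal M)"
    using ntf k by (auto simp: normally_torsion_free_def ideal_power_mono_ideal[OF upset_M])
  then obtain t where t: "t \<in> bmons n" "supp t \<inter> V = {}" "\<And>v. v \<in> V \<Longrightarrow> mterm v 1 + t \<in> M"
    and facet: "facet n E (vars_upto n - V)"
    using facet_if_associated[OF m'(2)] by blast
  have "vars_upto n - (vars_upto n - V) = V" using m'(2) by blast
  then have "k \<le> vdeg V m"
    using facet.symbolic_power_vdeg[OF facet f] by (simp add: m_def)
  then have "k \<le> vdeg V m'"
    using sum_mono[of V "cf m" "cf m'"] m'(3) by (simp add: vdeg_def)
  \<comment> \<open>Split \<open>k\<close> variables of \<open>V\<close> off \<open>m'\<close>; each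
    of them times \<open>t\<close> lies in \<open>M\<close>. So t^k m' is in the k-th power although
    t^k avoids \<open>V\<close>, contrary to the colon ideal being (V).\<close>
  then have "\<exists>u \<in> bmons n. supp u \<inter> V = {} \<and> u + m' \<in> mpow n M k"
    using m'(1)
  proof (induction k arbitrary: m')
    case 0
    then show ?case by (intro bexI[of _ 0]) auto
  next
    case (Suc k)
    then have "vdeg V m' \<noteq> 0" by simp
    then obtain v where v: "v \<in> supp m'" "v \<in> V" by (auto simp: vdeg_eq_0_iff[OF fin])
    define a where "a = m' - mterm v 1"
    have a: "m' = a + mterm v 1"
      using v(1) by (intro poly_mapping_eqI) (auto simp: a_def lookup_add lookup_minus lookup_single when_def in_keys_iff)
    have "vdeg V (mterm v 1) = 1"
      using fin v(2) by (simp add: vdeg_def lookup_single when_def sum.delta)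
    then have "k \<le> vdeg V a" "a \<in> bmons n" using Suc.prems by (simp_all add: a)
    then obtain u where u: "u \<in> bmons n" "supp u \<inter> V = {}" "u + a \<in> mpow n M k"
      using Suc.IH by blast
    have "(u + a) + (mterm v 1 + t) \<in> mpow n M (Suc k)"
      using u(3) t(3)[OF v(2)] by auto
    then show ?case
      using u t by (intro bexI[of _ "u + t"]) (auto simp: supp_add_nat a ac_simps)
  qed
  then show False using colon by blast
qed

lemma symbolic_power_J:
  assumes "normally_torsion_free (bpoly_ring n) (initial_ideal n (J :: 'k::field bpoly set))" "k \<ge> 1"
  shows "symbolic_power (bpoly_ring n) (J :: 'k bpoly set) k = ideal_power (bpoly_ring n) J k" (is "?S = ?I")
proof
  have I: "ideal ?I (bpoly_ring n)" by (rule ideal_ideal_power[OF ideal_J])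
  show "?S \<subseteq> ?I"
  proof
    fix f :: "'k bpoly" assume f: "f \<in> ?S"
    then obtain w where w: "w \<in> carrier (bpoly_ring n)" "w \<notin> \<Union> (min_primes (bpoly_ring n) J)" "w * f \<in> ?I"
      by (auto simp: symbolic_power_def)
    \<comment> \<open>Fixing the one multiplier \<open>w\<close> gives the colon ideal of the power
      by \<open>w\<close>: an ideal that contains \<open>f\<close> and lies inside the symbolic
      power, so leading monomials can be compared.\<close>
    define N where "N = {g \<in> carrier (bpoly_ring n). w * g \<in> ?I}"
    have "ideal N (bpoly_ring n)"
    proof (rule bideal_I)
      show "p + q \<in> N" if "p \<in> N" "q \<in> N" for p q
        using that bideal_add[OF I, of "w * p" "w * q"] by (auto simp: N_def carrier_add distrib_left)
      show "a * p \<in> N" if "a \<in> carrier (bpoly_ring n)" "p \<in> N" for a p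
        using that bideal_mult[OF I that(1), of "w * p"] by (auto simp: N_def carrier_mult mult.left_commute)
    qed (auto simp: N_def carrier_iff bideal_0[OF I])
    moreover have "?I \<subseteq> N"
      using bideal_mult[OF I w(1)] bideal_carrier[OF I] by (auto simp: N_def)
    moreover have "LM N \<subseteq> LM ?I"
    proof -
      have "N \<subseteq> ?S" using w(1,2) by (auto simp: N_def symbolic_power_def)
      then have "LM N \<subseteq> mpow n M k"
        using symbolic_power_lead_mon[OF assms] by (auto simp: LM_def)
      moreover have "mpow n (LM (J :: 'k bpoly set)) k \<subseteq> LM ?I" by (rule mpow_LM_subset[OF ideal_J])
      ultimately show ?thesis unfolding LM_J M_def by blast
    qed
    ultimately have "N = ?I" using I by (intro eq_if_LM_subset)
    moreover have "f \<in> N" using f w(3) by (simp add: N_def symbolic_power_def)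
    ultimately show "f \<in> ?I" by simp
  qed
  show "?I \<subseteq> ?S"
  proof
    fix f :: "'k bpoly" assume f: "f \<in> ?I"
    have "1 \<notin> Q" if "primeideal Q (bpoly_ring n)" for Q :: "'k bpoly set"
    proof
      assume one: "1 \<in> Q"
      interpret primeideal Q "bpoly_ring n" by fact
      have "Q = carrier (bpoly_ring n)"
        using bideal_mult[OF is_ideal _ one] bideal_carrier[OF is_ideal] by fastforce
      then show False using I_notcarr by simp
    qed
    then have "1 \<notin> \<Union> (min_primes (bpoly_ring n) (J :: 'k bpoly set))" by (auto simp: min_primes_def)
    then show "f \<in> ?S"
      unfolding symbolic_power_def using f bideal_carrier[OF I f]
      by (auto simp: carrier_iff intro!: bexI[of _ 1])
  qed
qed

end

theorem theorem3p3:
  fixes n :: nat and G :: "nat pair_pre_digraph" and J :: "('k::field) bpoly set"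
  assumes "pair_graph G"
    and "pverts G = {1..n}"
    and "Digraph_Component.connected (with_proj G)"
    and "J = binomial_edge_ideal n G"
    and "normally_torsion_free (bpoly_ring n) (initial_ideal n J)"
  shows "\<forall>k::nat. k \<ge> 1 \<longrightarrow> symbolic_power (bpoly_ring n) J k = ideal_power (bpoly_ring n) J k"
proof -
  interpret pair_graph G by fact
  interpret edge_graph n "parcs G"
  proof
    show "parcs G \<subseteq> {1..n} \<times> {1..n}" using in_arcsD1 in_arcsD2 assms(2) by auto
    show "(j, i) \<in> parcs G" if "(i, j) \<in> parcs G" for i j
      using that pair_sym_arcs by (auto simp: symmetric_def sym_def)
  qed
  have eq: "J = edge_graph.J n (parcs G)"
    unfolding assms(4) binomial_edge_ideal_def J_def by (simp add: minor_def var_def x_poly_def y_poly_def)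
  show ?thesis
  proof (intro allI impI)
    fix k :: nat assume k: "k \<ge> 1"
    show "symbolic_power (bpoly_ring n) J k = ideal_power (bpoly_ring n) J k"
      unfolding eq by (rule symbolic_power_J[OF assms(5)[unfolded eq] k])
  qed
qed

end
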